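(* For any sequence of Banach spaces $\{X_n\}_{n\in\mathbb{N}}$ and any free ultrafilter $\mathcal{U}$ on $\mathbb{N}$, $$n\Big(\prod_{\mathcal{U}}X_n\Big)\le\lim_{\mathcal{U}} n(X_n).$$
   Context: Banach spaces are over $\mathbb{K}$ ($\mathbb{R}$ or $\mathbb{C}$). For a Banach space $E$, $\mathcal{L}(E)$ denotes the bounded linear operators on $E$, $S_E$ the unit sphere, $E^*$ the dual space. Numerical radius and index: for $T\in\mathcal{L}(E)$, $$v(T)=\sup\{|x^*(Tx)| : x\in S_E,\ x^*\in S_{E^*},\ x^*(x)=1\},$$ and $n(E)=\inf\{v(T): T\in\mathcal{L}(E),\ \|T\|=1\}$. Ultraproduct: for Banach spaces $\{X_n\}_{n\in\mathbb{N}}$ and a free (non-principal) ultrafilter $\mathcal{U}$ on $\mathbb{N}$, $\prod_{\mathcal{U}}X_n=\ell_\infty(\{X_n\})/c_{0,\mathcal{U}}(\{X_n\})$, where $\ell_\infty(\{X_n\})$ is the space of bounded sequences $(x_n)$ with $x_n\in X_n$ (sup norm) and $c_{0,\mathcal{U}}(\{X_n\})=\{(x_n)\in\ell_\infty(\{X_n\}):\lim_{\mathcal{U}}\|x_n\|=0\}$; the quotient norm of the class $(x_n)_{\mathcal{U}}$ is $\lim_{\mathcal{U}}\|x_n\|$. Here $\lim_{\mathcal{U}}$ denotes the limit of a bounded scalar sequence along $\mathcal{U}$. *)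

theory Defs
  imports "HOL-Analysis.Analysis" "HOL-Algebra.Module" "HOL-Algebra.AbelCoset"
begin

section \<open>Normed spaces over a field of scalars K\<close>

text \<open>
  Spaces have explicit carriers, so that the members of a sequence of type
  \<open>nat \<Rightarrow> 'a nspace\<close> are unrelated spaces; sharing the type \<open>'a\<close> is no restriction, since
  the carriers can be copied into a common (e.g. disjoint sum) type. The scalar field
  is a set of complex numbers (either \<open>\<real>\<close> or \<open>UNIV\<close>); only scalars from this set are ever used.
  The ring multiplication and unit that the record type of modules inherits from rings
  play no role for vectors.
\<close>

record 'a nspace = "(complex, 'a) module" +
  vnorm :: "'a \<Rightarrow> real"

definition scalar_space :: "complex set \<Rightarrow> complex nspace" where
  "scalar_space K = \<lparr>carrier = K, mult = (*), one = 1, zero = 0, add = (+), smult = (*), vnorm = cmod\<rparr>"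

locale normed_space = module "scalar_space K" E
  for K :: "complex set" and E :: "'a nspace" (structure) +
  assumes vnorm_eq_0: "x \<in> carrier E \<Longrightarrow> vnorm E x = 0 \<longleftrightarrow> x = \<zero>"
    and vnorm_smult: "a \<in> K \<Longrightarrow> x \<in> carrier E \<Longrightarrow> vnorm E (a \<odot> x) = cmod a * vnorm E x"
    and vnorm_triangle: "x \<in> carrier E \<Longrightarrow> y \<in> carrier E \<Longrightarrow> vnorm E (x \<oplus> y) \<le> vnorm E x + vnorm E y"

text \<open>The locale \<^locale>\<open>Metric_space\<close> requires nonnegativity and symmetry of the distance also
  outside of the carrier, hence the guard.\<close>

definition vdist :: "'a nspace \<Rightarrow> 'a \<Rightarrow> 'a \<Rightarrow> real" where
  "vdist E x y = (if x \<in> carrier E \<and> y \<in> carrier E then vnorm E (x \<ominus>\<^bsub>E\<^esub> y) else 0)"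

locale banach_space = normed_space +
  assumes complete: "Metric_space.mcomplete (carrier E) (vdist E)"

definition unit_sphere :: "'a nspace \<Rightarrow> 'a set" where
  "unit_sphere E = {x \<in> carrier E. vnorm E x = 1}"


section \<open>Bounded operators, numerical radius and numerical index\<close>

definition bounded_ops :: "complex set \<Rightarrow> 'a nspace \<Rightarrow> 'b nspace \<Rightarrow> ('a \<Rightarrow> 'b) set" where
  "bounded_ops K E F = {T \<in> carrier E \<rightarrow> carrier F.
     (\<forall>x\<in>carrier E. \<forall>y\<in>carrier E. T (x \<oplus>\<^bsub>E\<^esub> y) = T x \<oplus>\<^bsub>F\<^esub> T y) \<and>
     (\<forall>a\<in>K. \<forall>x\<in>carrier E. T (a \<odot>\<^bsub>E\<^esub> x) = a \<odot>\<^bsub>F\<^esub> T x) \<and>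
     (\<exists>C. \<forall>x\<in>carrier E. vnorm F (T x) \<le> C * vnorm E x)}"

definition op_norm :: "'a nspace \<Rightarrow> 'b nspace \<Rightarrow> ('a \<Rightarrow> 'b) \<Rightarrow> real" where
  "op_norm E F T = Sup {vnorm F (T x) |x. x \<in> carrier E \<and> vnorm E x \<le> 1}"

definition dual_unit_sphere :: "complex set \<Rightarrow> 'a nspace \<Rightarrow> ('a \<Rightarrow> complex) set" where
  "dual_unit_sphere K E =
     {f \<in> bounded_ops K E (scalar_space K). op_norm E (scalar_space K) f = 1}"

definition numerical_radius :: "complex set \<Rightarrow> 'a nspace \<Rightarrow> ('a \<Rightarrow> 'a) \<Rightarrow> real" where
  "numerical_radius K E T =
     Sup {cmod (f (T x)) |x f. x \<in> unit_sphere E \<and> f \<in> dual_unit_sphere K E \<and> f x = 1}"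

text \<open>On the zero space no operator has norm 1; the index is then \<open>Inf {}\<close>, the same
  (unspecified) real number for all zero spaces.\<close>

definition numerical_index :: "complex set \<Rightarrow> 'a nspace \<Rightarrow> real" where
  "numerical_index K E =
     Inf {numerical_radius K E T |T. T \<in> bounded_ops K E E \<and> op_norm E E T = 1}"


section \<open>Ultraproducts\<close>

definition free_ultrafilter :: "'i filter \<Rightarrow> bool" where
  "free_ultrafilter U \<longleftrightarrow>
     U \<noteq> bot \<and>
     (\<forall>P. eventually P U \<or> eventually (\<lambda>i. \<not> P i) U) \<and>
     (\<forall>A. U \<noteq> principal A)"

definition linf :: "('i \<Rightarrow> 'a nspace) \<Rightarrow> ('i \<Rightarrow> 'a) nspace" where
  "linf X =
     \<lparr>carrier = {x. (\<forall>i. x i \<in> carrier (X i)) \<and> bdd_above (range (\<lambda>i. vnorm (X i) (x i)))},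
      mult = undefined, one = undefined,
      zero = (\<lambda>i. \<zero>\<^bsub>X i\<^esub>),
      add = (\<lambda>x y i. x i \<oplus>\<^bsub>X i\<^esub> y i),
      smult = (\<lambda>a x i. a \<odot>\<^bsub>X i\<^esub> x i),
      vnorm = (\<lambda>x. SUP i. vnorm (X i) (x i))\<rparr>"

definition c0 :: "'i filter \<Rightarrow> ('i \<Rightarrow> 'a nspace) \<Rightarrow> ('i \<Rightarrow> 'a) set" where
  "c0 U X = {x \<in> carrier (linf X). ((\<lambda>i. vnorm (X i) (x i)) \<longlongrightarrow> 0) U}"

definition quotient_space :: "'a nspace \<Rightarrow> 'a set \<Rightarrow> 'a set nspace" where
  "quotient_space E N =
     \<lparr>carrier = a_rcosets\<^bsub>E\<^esub> N,
      mult = undefined, one = undefined,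
      zero = N,
      add = (<+>\<^bsub>E\<^esub>),
      smult = (\<lambda>a A. \<Union>x\<in>A. N +>\<^bsub>E\<^esub> (a \<odot>\<^bsub>E\<^esub> x)),
      vnorm = (\<lambda>A. INF x\<in>A. vnorm E x)\<rparr>"

definition ultraproduct :: "'i filter \<Rightarrow> ('i \<Rightarrow> 'a nspace) \<Rightarrow> ('i \<Rightarrow> 'a) set nspace" where
  "ultraproduct U X = quotient_space (linf X) (c0 U X)"


section \<open>Limits along an ultrafilter, and the norm of an ultraproduct\<close>

lemma free_ultrafilter_tendsto_Lim:
  fixes f :: "'i \<Rightarrow> real"
  assumes U: "free_ultrafilter U" and f: "bounded (range f)"
  shows "(f \<longlongrightarrow> Lim U f) U"
proof -
  have nb: "U \<noteq> bot" and ultra: "\<And>P. eventually P U \<or> eventually (\<lambda>i. \<not> P i) U"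
    using U by (auto simp: free_ultrafilter_def)
  define S where "S = closure (range f)"
  have S: "compact S" using f by (simp add: S_def compact_closure)
  have "filtermap f U \<le> principal S"
    unfolding le_principal eventually_filtermap
    by (rule always_eventually) (auto simp: S_def intro: closure_subset[THEN subsetD])
  moreover have "filtermap f U \<noteq> bot" using nb by (simp add: filtermap_bot_iff)
  ultimately obtain l where l: "inf (nhds l) (filtermap f U) \<noteq> bot"
    using S unfolding compact_filter eventually_principal le_principal by blast
  have "(f \<longlongrightarrow> l) U"
  proof (rule topological_tendstoI)
    fix V :: "real set" assume V: "open V" "l \<in> V"
    show "\<forall>\<^sub>F i in U. f i \<in> V"
    proof (rule ccontr)
      assume "\<not> (\<forall>\<^sub>F i in U. f i \<in> V)"
      then have "\<forall>\<^sub>F i in U. f i \<notin> V" using ultra[of "\<lambda>i. f i \<in> V"] by blast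
      then have "\<forall>\<^sub>F y in filtermap f U. y \<notin> V" by (simp add: eventually_filtermap)
      moreover have "\<forall>\<^sub>F y in nhds l. y \<in> V" using V by (rule eventually_nhds_in_open)
      ultimately have "\<forall>\<^sub>F y in inf (nhds l) (filtermap f U). False"
        unfolding eventually_inf by blast
      then show False using l by (simp add: trivial_limit_def)
    qed
  qed
  then show ?thesis using nb by (simp add: tendsto_Lim)
qed

lemma (in normed_space) vnorm_basic:
  assumes K: "K = \<real> \<or> K = UNIV"
  shows "\<And>x. x \<in> carrier E \<Longrightarrow> vnorm E (\<ominus> x) = vnorm E x"
    and "\<And>x. x \<in> carrier E \<Longrightarrow> 0 \<le> vnorm E x"
    and "vnorm E \<zero> = 0"
proof -
  show z: "vnorm E \<zero> = 0" using vnorm_eq_0[of \<zero>] by simp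
  have m1: "-1 \<in> K" "1 \<in> K" and R: "carrier (scalar_space K) = K" "one (scalar_space K) = 1"
    "add (scalar_space K) = (+)" "zero (scalar_space K) = 0"
    using K by (auto simp: scalar_space_def)
  have neg: "\<ominus> x = (-1) \<odot> x" if x: "x \<in> carrier E" for x
  proof -
    have "(-1) \<odot> x \<oplus> 1 \<odot> x = (-1 + 1) \<odot> x"
      using smult_l_distr[of "-1" 1 x] m1 x R by simp
    also have "\<dots> = \<zero>" using smult_l_null[OF x] R by simp
    finally have "(-1) \<odot> x \<oplus> x = \<zero>" using smult_one[OF x] R by simp
    moreover have "(-1) \<odot> x \<in> carrier E" using smult_closed[of "-1" x] m1 x R by simp
    ultimately show ?thesis using x by (metis M.minus_equality)
  qed
  show n: "vnorm E (\<ominus> x) = vnorm E x" if "x \<in> carrier E" for x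
    using neg[OF that] vnorm_smult[of "-1" x] m1 that by simp
  show "0 \<le> vnorm E x" if "x \<in> carrier E" for x
    using vnorm_triangle[of x "\<ominus> x"] n[OF that] that z by (simp add: M.r_neg)
qed

lemma vnorm_ultraproduct:
  assumes K: "K = \<real> \<or> K = UNIV" and U: "free_ultrafilter U"
    and X: "\<And>i. normed_space K (X i)" and x: "x \<in> carrier (linf X)"
  shows "vnorm (ultraproduct U X) (c0 U X +>\<^bsub>linf X\<^esub> x) = Lim U (\<lambda>i. vnorm (X i) (x i))"
proof -
  interpret N: normed_space K "X i" for i by (rule X)
  note nb = N.vnorm_basic[OF K]
  have nontriv: "U \<noteq> bot" using U by (simp add: free_ultrafilter_def)
  define L where "L = Lim U (\<lambda>i. vnorm (X i) (x i))"
  have xc: "x i \<in> carrier (X i)" for i using x by (simp add: linf_def)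
  obtain B where B: "vnorm (X i) (x i) \<le> B" for i
    using x by (auto simp: linf_def bdd_above_def)
  have "bounded (range (\<lambda>i. vnorm (X i) (x i)))"
    using B nb(2)[OF xc] by (intro boundedI[of _ B]) auto
  then have lim: "((\<lambda>i. vnorm (X i) (x i)) \<longlongrightarrow> L) U"
    unfolding L_def by (rule free_ultrafilter_tendsto_Lim[OF U])
  have coset: "c0 U X +>\<^bsub>linf X\<^esub> x = (\<lambda>h i. h i \<oplus>\<^bsub>X i\<^esub> x i) ` c0 U X"
    by (auto simp: a_r_coset_def' linf_def)
  define A where "A = c0 U X +>\<^bsub>linf X\<^esub> x"
  have lower: "L \<le> vnorm (linf X) y" if yA: "y \<in> A" for y
  proof -
    obtain h where h: "h \<in> c0 U X" and y: "y = (\<lambda>i. h i \<oplus>\<^bsub>X i\<^esub> x i)"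
      using yA coset by (auto simp: A_def)
    have hc: "h i \<in> carrier (X i)" for i using h by (simp add: c0_def linf_def)
    obtain C where C: "vnorm (X i) (h i) \<le> C" for i
      using h by (auto simp: c0_def linf_def bdd_above_def)
    have up: "vnorm (X i) (y i) \<le> C + B" for i
      using N.vnorm_triangle[OF hc xc, of i] C[of i] B[of i] by (simp add: y)
    have "vnorm (X i) (x i) - vnorm (X i) (h i) \<le> vnorm (X i) (y i)" for i
    proof -
      have "\<ominus>\<^bsub>X i\<^esub> h i \<oplus>\<^bsub>X i\<^esub> y i = x i"
        using hc xc by (simp add: y N.M.r_neg1)
      then show ?thesis
        using N.vnorm_triangle[of "\<ominus>\<^bsub>X i\<^esub> h i" i "y i"] nb(1)[OF hc] hc xc by (simp add: y)
    qed
    moreover have "vnorm (X i) (y i) \<le> vnorm (linf X) y" for i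
      unfolding linf_def using up by (auto intro!: cSUP_upper bdd_aboveI2)
    ultimately have "vnorm (X i) (x i) - vnorm (X i) (h i) \<le> vnorm (linf X) y" for i
      by (meson order_trans)
    moreover have "((\<lambda>i. vnorm (X i) (x i) - vnorm (X i) (h i)) \<longlongrightarrow> L - 0) U"
      using lim h by (intro tendsto_diff) (auto simp: c0_def)
    ultimately show ?thesis
      using tendsto_upperbound[OF _ _ nontriv] by fastforce
  qed
  have upper: "\<exists>y\<in>A. vnorm (linf X) y \<le> L + e" if e: "e > 0" for e
  proof -
    define h where "h i = (if vnorm (X i) (x i) < L + e then \<zero>\<^bsub>X i\<^esub> else \<ominus>\<^bsub>X i\<^esub> x i)" for i
    have ev: "\<forall>\<^sub>F i in U. vnorm (X i) (x i) < L + e"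
      using order_tendstoD(2)[OF lim, of "L + e"] e by simp
    have L0: "0 \<le> L"
      using lim nb(2)[OF xc] nontriv by (intro tendsto_lowerbound[OF lim]) auto
    have "0 \<le> B" using B nb(2)[OF xc] order_trans by blast
    have "h \<in> carrier (linf X)"
      using xc nb(1)[OF xc] nb(3) B \<open>0 \<le> B\<close> by (auto simp: linf_def h_def intro!: bdd_aboveI2[of _ _ B])
    moreover have "((\<lambda>i. vnorm (X i) (h i)) \<longlongrightarrow> 0) U"
      by (rule tendsto_eventually) (use ev in eventually_elim, simp add: h_def nb(3))
    ultimately have "h \<in> c0 U X" by (simp add: c0_def)
    then have "(\<lambda>i. h i \<oplus>\<^bsub>X i\<^esub> x i) \<in> A" by (auto simp: A_def coset)
    moreover have "vnorm (linf X) (\<lambda>i. h i \<oplus>\<^bsub>X i\<^esub> x i) \<le> L + e"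
    proof -
      have "vnorm (X i) (h i \<oplus>\<^bsub>X i\<^esub> x i) \<le> L + e" for i
        using xc[of i] L0 e nb(3) by (auto simp: h_def N.M.l_neg)
      then show ?thesis by (auto simp: linf_def intro: cSUP_least)
    qed
    ultimately show ?thesis by blast
  qed
  have ne: "A \<noteq> {}" using upper[of 1] by auto
  have "L \<le> (INF y\<in>A. vnorm (linf X) y)" using ne lower by (rule cINF_greatest)
  moreover have "(INF y\<in>A. vnorm (linf X) y) \<le> L"
  proof (rule field_le_epsilon)
    fix e :: real assume "e > 0"
    then obtain y where "y \<in> A" "vnorm (linf X) y \<le> L + e" using upper by blast
    then show "(INF y\<in>A. vnorm (linf X) y) \<le> L + e"
      using lower by (intro cINF_lower2[of _ _ y]) (auto intro!: bdd_belowI2)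
  qed
  ultimately show ?thesis
    by (simp add: ultraproduct_def quotient_space_def L_def A_def)
qed

end

theory Submission
  imports Defs
begin

text \<open>
  Choose operators \<open>T n\<close> of norm 1 on \<open>X n\<close> whose numerical radii nearly realise the numerical
  indices; they induce an operator of norm 1 on the ultraproduct. The numerical radius of an
  operator is defined through dual functionals, and those of the ultraproduct are not accessible
  from the factors. However, \<open>v(T) \<le> w\<close> implies (by Hahn--Banach, in each factor)
  \<open>(1 - \<bar>b\<bar> w) \<parallel>z + b T z\<parallel> \<le> (1 + \<bar>b\<bar>\<^sup>2) \<parallel>z\<parallel>\<close> for \<open>\<parallel>T\<parallel> \<le> 1\<close>. This is a statement about norms
  only, uniform in the factors, so it holds in the ultraproduct, and it gives \<open>v(T) \<le> w\<close> back as
  \<open>b \<rightarrow> 0\<close>.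
\<close>

section \<open>Norming functionals\<close>

text \<open>The dual of an ultraproduct can be strictly larger than the ultraproduct of the duals,
  so a functional supporting the unit ball at a class need not be a limit of supporting functionals
  in the factors.

  The right-hand side of the norm inequality is quadratic in b because (I - b T)(I + b T) = I - b^2
  T^2 differs from I only to second order, whereas 1 - |b| w carries w at first order. For the way
  back, let f be a norm-one functional with f x = 1 at a unit vector x, and turn b so that b f(T x)
  = |b| |f(T x)|. Then 1 + |b| |f(T x)| is at most the norm of x + b T x, and the first-order terms
  of the inequality compare |f(T x)| with w.

  Zero factors need separate care, since their index is the unspecified \<open>Inf {}\<close>. The
  ultrafilter decides: either almost all factors are zero, and both sides of the claim are
  \<open>Inf {}\<close>, or almost all are nonzero, and the exceptions do not affect limits along
  \<open>U\<close>.\<close>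

locale scalar_normed_space = normed_space +
  assumes scalars: "K = \<real> \<or> K = UNIV"
begin

section \<open>Arithmetic of scalars and vectors\<close>

lemma scalar_simps:
  "carrier (scalar_space K) = K" "one (scalar_space K) = 1" "zero (scalar_space K) = 0"
  "add (scalar_space K) = (+)" "mult (scalar_space K) = (*)" "vnorm (scalar_space K) = cmod"
  "smult (scalar_space K) = (*)"
  by (simp_all add: scalar_space_def)

lemma scalars_closed:
  "complex_of_real t \<in> K" "0 \<in> K" "1 \<in> K"
  "a \<in> K \<Longrightarrow> b \<in> K \<Longrightarrow> a + b \<in> K" "a \<in> K \<Longrightarrow> b \<in> K \<Longrightarrow> a * b \<in> K"
  "a \<in> K \<Longrightarrow> - a \<in> K" "a \<in> K \<Longrightarrow> inverse a \<in> K"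
  using scalars by auto

lemmas smult_rules =
  smult_closed[unfolded scalar_simps] smult_l_distr[unfolded scalar_simps]
  smult_r_distr[unfolded scalar_simps] smult_assoc1[unfolded scalar_simps]
  smult_one[unfolded scalar_simps] smult_l_null[unfolded scalar_simps]
  smult_r_null[unfolded scalar_simps]

lemma smult_of_real_assoc:
  "x \<in> carrier E \<Longrightarrow> complex_of_real s \<odot> (complex_of_real t \<odot> x) = complex_of_real (s * t) \<odot> x"
  by (simp add: smult_rules scalars_closed)

lemma smult_minus_one:
  assumes "x \<in> carrier E"
  shows "(-1) \<odot> x = \<ominus> x"
proof -
  have "(-1) \<odot> x \<oplus> x = (-1 + 1) \<odot> x"
    using assms smult_rules(2)[of "-1" 1 x] by (simp add: smult_rules scalars_closed)
  then have "(-1) \<odot> x \<oplus> x = \<zero>"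
    using assms by (simp add: smult_rules)
  then show ?thesis
    using assms by (metis M.minus_equality smult_rules(1) scalars_closed(3,6))
qed

lemma smult_uminus:
  "a \<in> K \<Longrightarrow> x \<in> carrier E \<Longrightarrow> (- a) \<odot> x = \<ominus> (a \<odot> x)"
  using smult_rules(4)[of "-1" a x] by (simp add: smult_minus_one smult_rules scalars_closed)

lemmas vnorm_minus = vnorm_basic(1)[OF scalars]
lemmas vnorm_nonneg = vnorm_basic(2)[OF scalars]
lemmas vnorm_zero = vnorm_basic(3)[OF scalars]

lemma vnorm_of_real_smult:
  "x \<in> carrier E \<Longrightarrow> 0 \<le> t \<Longrightarrow> vnorm E (complex_of_real t \<odot> x) = t * vnorm E x"
  by (simp add: vnorm_smult scalars_closed)

lemma minus_zero: "\<ominus> \<zero> = \<zero>"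
  by (rule M.minus_equality) simp_all

lemma vnorm_pos: "x \<in> carrier E \<Longrightarrow> x \<noteq> \<zero> \<Longrightarrow> 0 < vnorm E x"
  using vnorm_eq_0 vnorm_nonneg by fastforce

lemma normalized_vector:
  assumes "x \<in> carrier E" "x \<noteq> \<zero>"
  shows "complex_of_real (1 / vnorm E x) \<odot> x \<in> carrier E"
    "vnorm E (complex_of_real (1 / vnorm E x) \<odot> x) = 1"
  using assms vnorm_pos[OF assms]
  by (simp_all add: smult_rules scalars_closed vnorm_of_real_smult del: of_real_divide)

text \<open>Positive homogeneity is only required as an inequality, which passes to infima directly;
  equality follows. Functionals vanish off the carrier so that the pointwise order on the
  carrier is antisymmetric.\<close>

definition sublinear :: "('a \<Rightarrow> real) \<Rightarrow> bool" where
  "sublinear p \<longleftrightarrow>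
     (\<forall>x\<in>carrier E. \<forall>y\<in>carrier E. p (x \<oplus> y) \<le> p x + p y) \<and>
     (\<forall>t\<ge>0. \<forall>x\<in>carrier E. p (complex_of_real t \<odot> x) \<le> t * p x) \<and>
     (\<forall>x\<in>carrier E. p x \<le> vnorm E x) \<and>
     (\<forall>x. x \<notin> carrier E \<longrightarrow> p x = 0)"

lemma sublinear_vnorm: "sublinear (\<lambda>x. if x \<in> carrier E then vnorm E x else 0)"
  by (auto simp: sublinear_def vnorm_triangle smult_rules vnorm_of_real_smult scalars_closed)

section \<open>Sublinear functionals bounded by the norm\<close>

context
  fixes p assumes p: "sublinear p"
begin

lemma sublinear_add: "x \<in> carrier E \<Longrightarrow> y \<in> carrier E \<Longrightarrow> p (x \<oplus> y) \<le> p x + p y"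
  and sublinear_smult_le: "0 \<le> t \<Longrightarrow> x \<in> carrier E \<Longrightarrow> p (complex_of_real t \<odot> x) \<le> t * p x"
  and sublinear_le_vnorm: "x \<in> carrier E \<Longrightarrow> p x \<le> vnorm E x"
  and sublinear_off_carrier: "x \<notin> carrier E \<Longrightarrow> p x = 0"
  using p by (auto simp: sublinear_def)

lemma sublinear_zero: "p \<zero> = 0"
  using sublinear_add[of \<zero> \<zero>] sublinear_smult_le[of 0 \<zero>] by (simp add: smult_rules)

text \<open>For \<open>t > 0\<close> the reverse inequality is the one in the definition, taken with
  the factor \<open>1 / t\<close> at the vector \<open>t\<close> times \<open>x\<close>.\<close>

lemma sublinear_smult:
  assumes "0 \<le> t" "x \<in> carrier E"
  shows "p (complex_of_real t \<odot> x) = t * p x"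
proof (cases "t = 0")
  case True
  then show ?thesis using assms sublinear_zero by (simp add: smult_rules)
next
  case False
  have "p x \<le> (1 / t) * p (complex_of_real t \<odot> x)"
    using sublinear_smult_le[of "1 / t" "complex_of_real t \<odot> x"] assms False
    by (simp add: smult_of_real_assoc smult_rules scalars_closed del: of_real_divide)
  then have "t * p x \<le> p (complex_of_real t \<odot> x)"
    using assms False by (simp add: field_simps)
  then show ?thesis using sublinear_smult_le assms by fastforce
qed

lemma sublinear_minus_ge: "x \<in> carrier E \<Longrightarrow> - p (\<ominus> x) \<le> p x"
  using sublinear_add[of x "\<ominus> x"] by (simp add: M.r_neg sublinear_zero)

lemma sublinear_ge_vnorm: "x \<in> carrier E \<Longrightarrow> - vnorm E x \<le> p x"
  using sublinear_minus_ge[of x] sublinear_le_vnorm[of "\<ominus> x"] by (simp add: vnorm_minus)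

text \<open>For \<open>y\<close> in the carrier this is the largest sublinear
  \<open>q \<le> p\<close> with \<open>q (\<ominus> y) \<le> - p y\<close>: any such q satisfies
  q(x) \<le> q(x + t y) + t q(-y) \<le> p(x + t y) - t p(y). Passing to it forces linearity along
  \<open>y\<close>.\<close>

definition steepened :: "'a \<Rightarrow> 'a \<Rightarrow> real" where
  "steepened y x =
     (if x \<in> carrier E then INF t\<in>{0..}. p (x \<oplus> complex_of_real t \<odot> y) - t * p y else 0)"

lemma steepened_le:
  assumes "x \<in> carrier E" "y \<in> carrier E" "0 \<le> t"
  shows "steepened y x \<le> p (x \<oplus> complex_of_real t \<odot> y) - t * p y"
proof -
  \<comment> \<open>A lower bound independent of \<open>s\<close>; without one the real infimum
    would carry no information.\<close>
  have "- p (\<ominus> x) \<le> p (x \<oplus> complex_of_real s \<odot> y) - s * p y" if "0 \<le> s" for s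
  proof -
    have "\<ominus> x \<oplus> (x \<oplus> complex_of_real s \<odot> y) = complex_of_real s \<odot> y"
      using assms by (simp add: M.r_neg1 smult_rules scalars_closed)
    then show ?thesis
      using sublinear_add[of "\<ominus> x" "x \<oplus> complex_of_real s \<odot> y"] sublinear_smult[of s y] assms that
      by (simp add: smult_rules scalars_closed)
  qed
  then have "bdd_below ((\<lambda>t. p (x \<oplus> complex_of_real t \<odot> y) - t * p y) ` {0..})"
    by (auto intro!: bdd_belowI2)
  then show ?thesis
    using assms by (auto simp: steepened_def intro: cINF_lower)
qed

lemma steepened_greatest:
  assumes "x \<in> carrier E" "\<And>t. 0 \<le> t \<Longrightarrow> c \<le> p (x \<oplus> complex_of_real t \<odot> y) - t * p y"
  shows "c \<le> steepened y x"
  using assms by (auto simp: steepened_def intro!: cINF_greatest)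

lemma steepened_le_self: "x \<in> carrier E \<Longrightarrow> y \<in> carrier E \<Longrightarrow> steepened y x \<le> p x"
  using steepened_le[of x y 0] by (simp add: smult_rules)

lemma sublinear_steepened:
  assumes y: "y \<in> carrier E"
  shows "sublinear (steepened y)"
  unfolding sublinear_def
proof (intro conjI ballI allI impI)
  fix x x' assume x: "x \<in> carrier E" "x' \<in> carrier E"
  \<comment> \<open>The parameters for \<open>x\<close> and \<open>x'\<close> vary independently,
    and their sum serves as parameter for \<open>x \<oplus> x'\<close>. The infimum over each of
    them is then taken in turn.\<close>
  have "steepened y (x \<oplus> x') \<le>
      (p (x \<oplus> complex_of_real t \<odot> y) - t * p y) + (p (x' \<oplus> complex_of_real s \<odot> y) - s * p y)"
    if "0 \<le> t" "0 \<le> s" for t s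
  proof -
    have "(x \<oplus> x') \<oplus> complex_of_real (t + s) \<odot> y
        = (x \<oplus> complex_of_real t \<odot> y) \<oplus> (x' \<oplus> complex_of_real s \<odot> y)"
      using x y by (simp add: smult_rules scalars_closed M.a_ac)
    then show ?thesis
      using steepened_le[of "x \<oplus> x'" y "t + s"] x y that
        sublinear_add[of "x \<oplus> complex_of_real t \<odot> y" "x' \<oplus> complex_of_real s \<odot> y"]
      by (simp add: smult_rules scalars_closed algebra_simps)
  qed
  then have "steepened y (x \<oplus> x') - (p (x \<oplus> complex_of_real t \<odot> y) - t * p y) \<le> steepened y x'"
    if "0 \<le> t" for t
    using that x by (intro steepened_greatest) (simp_all add: add.commute diff_le_eq)
  then have "steepened y (x \<oplus> x') - steepened y x' \<le> steepened y x"
    using x by (intro steepened_greatest) (auto simp: algebra_simps)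
  then show "steepened y (x \<oplus> x') \<le> steepened y x + steepened y x'" by simp
next
  fix s :: real and x assume s: "0 \<le> s" and x: "x \<in> carrier E"
  show "steepened y (complex_of_real s \<odot> x) \<le> s * steepened y x"
  proof (cases "s = 0")
    case True
    then show ?thesis
      using steepened_le_self[of \<zero> y] x y by (simp add: sublinear_zero smult_rules)
  next
    case False
    then have s: "s > 0" using s by simp
    have "steepened y (complex_of_real s \<odot> x) / s \<le> steepened y x"
    proof (rule steepened_greatest[OF x])
      fix t :: real assume t: "0 \<le> t"
      \<comment> \<open>Parameter \<open>s * t\<close> at the scaled vector corresponds to parameter
        \<open>t\<close> at \<open>x\<close>.\<close>
      have "complex_of_real s \<odot> x \<oplus> complex_of_real (s * t) \<odot> y
          = complex_of_real s \<odot> (x \<oplus> complex_of_real t \<odot> y)"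
        using x y by (simp add: smult_rules scalars_closed)
      then have "steepened y (complex_of_real s \<odot> x) \<le> s * (p (x \<oplus> complex_of_real t \<odot> y) - t * p y)"
        using steepened_le[of "complex_of_real s \<odot> x" y "s * t"] s t x y
          sublinear_smult[of s "x \<oplus> complex_of_real t \<odot> y"]
        by (simp add: smult_rules scalars_closed algebra_simps)
      then show "steepened y (complex_of_real s \<odot> x) / s \<le> p (x \<oplus> complex_of_real t \<odot> y) - t * p y"
        using s by (simp add: field_simps)
    qed
    then show ?thesis using s by (simp add: field_simps)
  qed
next
  fix x assume "x \<in> carrier E"
  then show "steepened y x \<le> vnorm E x"
    using steepened_le_self[OF _ y] sublinear_le_vnorm by fastforce
qed (simp add: steepened_def)

lemma steepened_minus: "y \<in> carrier E \<Longrightarrow> steepened y (\<ominus> y) \<le> - p y"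
  using steepened_le[of "\<ominus> y" y 1] by (simp add: smult_rules M.l_neg sublinear_zero)

end

text \<open>Subadditivity survives the infimum because, of two members of a chain, the pointwise
  smaller one can be used for both summands. The infimum is genuine: all members are bounded below
  by \<open>- vnorm E x\<close> on the carrier and vanish off it.\<close>

lemma sublinear_INF_chain:
  assumes C: "C \<noteq> {}" "\<And>p. p \<in> C \<Longrightarrow> sublinear p"
    and chain: "\<And>p q. p \<in> C \<Longrightarrow> q \<in> C \<Longrightarrow> (\<forall>x. p x \<le> q x) \<or> (\<forall>x. q x \<le> p x)"
  shows "sublinear (\<lambda>x. INF p\<in>C. p x)" "p \<in> C \<Longrightarrow> (INF p\<in>C. p x) \<le> p x"
proof -
  have low: "(INF p\<in>C. p x) \<le> p x" if "p \<in> C" for p x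
  proof (rule cINF_lower[OF _ that])
    show "bdd_below ((\<lambda>p. p x) ` C)"
    proof (cases "x \<in> carrier E")
      case True
      then show ?thesis using C(2) sublinear_ge_vnorm by (intro bdd_belowI2[of _ "- vnorm E x"]) auto
    next
      case False
      then show ?thesis using C(2) sublinear_off_carrier by (intro bdd_belowI2[of _ 0]) force
    qed
  qed
  then show "p \<in> C \<Longrightarrow> (INF p\<in>C. p x) \<le> p x" .
  define m where "m x = (INF p\<in>C. p x)" for x
  have ml: "m x \<le> p x" if "p \<in> C" for p x using low[OF that] by (simp add: m_def)
  have mg: "c \<le> m x" if "\<And>p. p \<in> C \<Longrightarrow> c \<le> p x" for c x
    unfolding m_def using C(1) that by (rule cINF_greatest)
  have "sublinear m"
    unfolding sublinear_def
  proof (intro conjI ballI allI impI)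
    fix x y assume xy: "x \<in> carrier E" "y \<in> carrier E"
    have pq: "m (x \<oplus> y) \<le> p x + q y" if "p \<in> C" "q \<in> C" for p q
      using chain[OF that]
    proof
      assume "\<forall>x. p x \<le> q x"
      then have "p y \<le> q y" by blast
      then show ?thesis using ml[OF that(1), of "x \<oplus> y"] sublinear_add[OF C(2)[OF that(1)] xy] by linarith
    next
      assume "\<forall>x. q x \<le> p x"
      then have "q x \<le> p x" by blast
      then show ?thesis using ml[OF that(2), of "x \<oplus> y"] sublinear_add[OF C(2)[OF that(2)] xy] by linarith
    qed
    have pm: "m (x \<oplus> y) - p x \<le> m y" if "p \<in> C" for p
    proof (rule mg)
      fix q assume "q \<in> C"
      with \<open>p \<in> C\<close> show "m (x \<oplus> y) - p x \<le> q y"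
        using pq[of p q] by simp
    qed
    have "m (x \<oplus> y) - m y \<le> m x"
    proof (rule mg)
      fix q assume "q \<in> C"
      then show "m (x \<oplus> y) - m y \<le> q x"
        using pm[of q] by simp
    qed
    then show "m (x \<oplus> y) \<le> m x + m y" by simp
  next
    fix t :: real and x assume t: "0 \<le> t" and x: "x \<in> carrier E"
    obtain p where "p \<in> C" using C(1) by blast
    show "m (complex_of_real t \<odot> x) \<le> t * m x"
    proof (cases "t = 0")
      case True
      then show ?thesis
        using ml[OF \<open>p \<in> C\<close>, of \<zero>] x sublinear_zero[OF C(2)[OF \<open>p \<in> C\<close>]] by (simp add: smult_rules)
    next
      case False
      have "m (complex_of_real t \<odot> x) / t \<le> m x"
      proof (rule mg)
        fix q assume "q \<in> C"
        then have "m (complex_of_real t \<odot> x) \<le> t * q x"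
          using ml sublinear_smult_le[OF C(2) t x] by (meson order_trans)
        then show "m (complex_of_real t \<odot> x) / t \<le> q x" using t False by (simp add: field_simps)
      qed
      then show ?thesis using t False by (simp add: field_simps)
    qed
  next
    obtain p where p: "p \<in> C" using C(1) by blast
    show "m x \<le> vnorm E x" if "x \<in> carrier E" for x
      using ml[OF p, of x] sublinear_le_vnorm[OF C(2)[OF p] that] by linarith
    show "m x = 0" if "x \<notin> carrier E" for x
      using ml[OF p, of x] sublinear_off_carrier[OF C(2) that] p mg[of 0 x] by fastforce
  qed
  then show "sublinear (\<lambda>x. INF p\<in>C. p x)" by (simp add: m_def[abs_def])
qed

lemma minimal_sublinear_exists:
  assumes p0: "sublinear p0"
  obtains p where "sublinear p" "\<And>x. p x \<le> p0 x"
    "\<And>q. sublinear q \<Longrightarrow> (\<And>x. q x \<le> p x) \<Longrightarrow> q = p"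
proof -
  define A where "A = {p. sublinear p \<and> (\<forall>x. p x \<le> p0 x)}"
  \<comment> \<open>The order is reversed, so that a maximal element from Zorn's lemma is a minimal
    functional and infima serve as upper bounds of chains. The empty chain is bounded by
    \<open>p0\<close> instead.\<close>
  define P where "P p q \<longleftrightarrow> (\<forall>x. q x \<le> p x)" for p q :: "'a \<Rightarrow> real"
  have "\<exists>m\<in>A. \<forall>a\<in>A. P m a \<longrightarrow> a = m"
  proof (rule predicate_Zorn)
    show "partial_order_on A (relation_of P A)"
      by (rule partial_order_on_relation_ofI) (auto simp: P_def fun_eq_iff intro: order_trans antisym)
    show "\<exists>u\<in>A. \<forall>a\<in>C. P a u" if "C \<in> Chains (relation_of P A)" for C
    proof (cases "C = {}")
      case True
      then show ?thesis using p0 by (auto simp: A_def)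
    next
      case False
      have CA: "C \<subseteq> A" using that by (rule Chains_relation_of)
      have ch: "(\<forall>x. p x \<le> q x) \<or> (\<forall>x. q x \<le> p x)" if "p \<in> C" "q \<in> C" for p q
        using \<open>C \<in> Chains _\<close> that by (auto simp: Chains_def relation_of_def P_def)
      have sub: "\<And>p. p \<in> C \<Longrightarrow> sublinear p" using CA by (auto simp: A_def)
      have inf: "sublinear (\<lambda>x. INF p\<in>C. p x)" using False sub ch by (rule sublinear_INF_chain(1))
      have inf_le: "(INF p\<in>C. p x) \<le> q x" if "q \<in> C" for q x
        using False sub ch that by (rule sublinear_INF_chain(2))
      obtain q where q: "q \<in> C" using False by blast
      have "(INF p\<in>C. p x) \<le> p0 x" for x
      proof -
        have "q x \<le> p0 x" using q CA by (auto simp: A_def)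
        with inf_le[OF q, of x] show ?thesis by linarith
      qed
      then have "(\<lambda>x. INF p\<in>C. p x) \<in> A" using inf by (simp add: A_def)
      moreover have "\<forall>a\<in>C. P a (\<lambda>x. INF p\<in>C. p x)" using inf_le by (simp add: P_def)
      ultimately show ?thesis by blast
    qed
  qed
  then obtain p where p: "p \<in> A" "\<And>a. a \<in> A \<Longrightarrow> P p a \<Longrightarrow> a = p" by blast
  show ?thesis
  proof (rule that)
    show "sublinear p" "\<And>x. p x \<le> p0 x" using p(1) by (auto simp: A_def)
    show "q = p" if "sublinear q" "\<And>x. q x \<le> p x" for q
    proof (rule p(2))
      show "q \<in> A" using that p(1) by (auto simp: A_def intro: order_trans)
    qed (simp add: P_def that)
  qed
qed

text \<open>A minimal sublinear functional equals all its steepenings, which makes it additive.\<close>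

lemma real_norming_functional:
  assumes x0: "x0 \<in> carrier E"
  obtains g where "g x0 = vnorm E x0"
    "\<And>x y. x \<in> carrier E \<Longrightarrow> y \<in> carrier E \<Longrightarrow> g (x \<oplus> y) = g x + g y"
    "\<And>t x. x \<in> carrier E \<Longrightarrow> g (complex_of_real t \<odot> x) = t * g x"
    "\<And>x. x \<in> carrier E \<Longrightarrow> g x \<le> vnorm E x"
proof -
  \<comment> \<open>Steepening the norm at \<open>x0\<close> before minimising forces
    \<open>g (\<ominus> x0) \<le> - vnorm E x0\<close>, hence \<open>g x0 = vnorm E x0\<close> once
    \<open>g\<close> is additive.\<close>
  define p0 where "p0 = steepened (\<lambda>x. if x \<in> carrier E then vnorm E x else 0) x0"
  have "sublinear p0" unfolding p0_def using sublinear_vnorm x0 by (rule sublinear_steepened)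
  then obtain g where g: "sublinear g" "\<And>x. g x \<le> p0 x"
    and minimal: "\<And>q. sublinear q \<Longrightarrow> (\<And>x. q x \<le> g x) \<Longrightarrow> q = g"
    using minimal_sublinear_exists by blast
  have steep: "steepened g y = g" if y: "y \<in> carrier E" for y
  proof (rule minimal)
    show "sublinear (steepened g y)" using g(1) y by (rule sublinear_steepened)
    show "steepened g y x \<le> g x" for x
      using steepened_le_self[OF g(1) _ y, of x] sublinear_off_carrier[OF g(1), of x]
      by (cases "x \<in> carrier E") (auto simp: steepened_def[OF g(1)])
  qed
  \<comment> \<open>Parameter 1 in the infimum for \<open>steepened g y = g\<close> gives
    \<open>g x \<le> g (x \<oplus> y) - g y\<close>, the converse of subadditivity.\<close>
  have add: "g (x \<oplus> y) = g x + g y" if "x \<in> carrier E" "y \<in> carrier E" for x y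
    using steepened_le[OF g(1) that, of 1] sublinear_add[OF g(1) that] that
    by (simp add: steep smult_rules)
  have neg: "g (\<ominus> x) = - g x" if "x \<in> carrier E" for x
    using add[OF that, of "\<ominus> x"] that by (simp add: M.r_neg sublinear_zero[OF g(1)])
  have smult: "g (complex_of_real t \<odot> x) = t * g x" if x: "x \<in> carrier E" for t x
  proof (cases "0 \<le> t")
    case True
    then show ?thesis using sublinear_smult[OF g(1)] x by blast
  next
    case False
    have "g (complex_of_real t \<odot> x) = - g (complex_of_real (- t) \<odot> x)"
      using neg[of "complex_of_real t \<odot> x"] x
      by (simp add: smult_uminus smult_rules scalars_closed)
    then show ?thesis using False sublinear_smult[OF g(1), of "- t" x] x by simp
  qed
  have "p0 (\<ominus> x0) \<le> - vnorm E x0"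
    unfolding p0_def using steepened_minus[OF sublinear_vnorm x0] x0 by simp
  then have "- g x0 \<le> - vnorm E x0"
    using neg[OF x0] g(2)[of "\<ominus> x0"] by simp
  then have "g x0 = vnorm E x0"
    using sublinear_le_vnorm[OF g(1) x0] by simp
  then show ?thesis
    using add smult sublinear_le_vnorm[OF g(1)] by (rule that)
qed

text \<open>The value \<open>c\<close> need not be attained; approaching it inside the unit ball is
  enough, and this is how the norm of an operator on the ultraproduct is found.\<close>

lemma op_norm_eqI:
  assumes "\<And>x. x \<in> carrier E \<Longrightarrow> vnorm F (T x) \<le> c * vnorm E x" "0 \<le> c"
    and "\<And>d. d < c \<Longrightarrow> \<exists>x\<in>carrier E. vnorm E x \<le> 1 \<and> d \<le> vnorm F (T x)"
  shows "op_norm E F T = c"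
proof -
  have le: "vnorm F (T x) \<le> c" if "x \<in> carrier E" "vnorm E x \<le> 1" for x
    using assms(1)[OF that(1)] mult_left_mono[OF that(2) assms(2)] by simp
  have ne: "{vnorm F (T x) |x. x \<in> carrier E \<and> vnorm E x \<le> 1} \<noteq> {}"
    using M.zero_closed vnorm_zero by (fastforce intro: exI[of _ \<zero>])
  show ?thesis
    unfolding op_norm_def
  proof (rule antisym)
    show "Sup {vnorm F (T x) |x. x \<in> carrier E \<and> vnorm E x \<le> 1} \<le> c"
      using ne le by (intro cSup_least) auto
    show "c \<le> Sup {vnorm F (T x) |x. x \<in> carrier E \<and> vnorm E x \<le> 1}"
    proof (rule dense_le)
      fix d assume "d < c"
      then obtain x where "x \<in> carrier E" "vnorm E x \<le> 1" "d \<le> vnorm F (T x)"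
        using assms(3) by blast
      then show "d \<le> Sup {vnorm F (T x) |x. x \<in> carrier E \<and> vnorm E x \<le> 1}"
        using le by (intro cSup_upper2[of "vnorm F (T x)"]) (auto intro!: bdd_aboveI)
    qed
  qed
qed

text \<open>Over the reals the real norming functional is already the answer; over the complex
  numbers it is the real part of the functional sought.\<close>

theorem norming_functional:
  assumes x0: "x0 \<in> carrier E" "x0 \<noteq> \<zero>"
  obtains f where "f \<in> dual_unit_sphere K E" "f x0 = vnorm E x0"
proof -
  have "\<exists>f. (\<forall>x\<in>carrier E. f x \<in> K \<and> cmod (f x) \<le> vnorm E x) \<and> f x0 = vnorm E x0 \<and>
      (\<forall>x\<in>carrier E. \<forall>y\<in>carrier E. f (x \<oplus> y) = f x + f y) \<and>
      (\<forall>a\<in>K. \<forall>x\<in>carrier E. f (a \<odot> x) = a * f x)"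
  proof -
    obtain g where g: "g x0 = vnorm E x0"
      and add: "\<And>x y. x \<in> carrier E \<Longrightarrow> y \<in> carrier E \<Longrightarrow> g (x \<oplus> y) = g x + g y"
      and smult: "\<And>t x. x \<in> carrier E \<Longrightarrow> g (complex_of_real t \<odot> x) = t * g x"
      and le: "\<And>x. x \<in> carrier E \<Longrightarrow> g x \<le> vnorm E x"
      using real_norming_functional[OF x0(1)] by blast
    have neg: "g (\<ominus> x) = - g x" if "x \<in> carrier E" for x
      using smult[OF that, of "-1"] that by (simp add: smult_minus_one)
    show ?thesis
    proof (cases "K = UNIV")
      case False
      then have K: "K = \<real>" using scalars by blast
      have "\<bar>g x\<bar> \<le> vnorm E x" if "x \<in> carrier E" for x
        using le[OF that] le[of "\<ominus> x"] that by (simp add: neg vnorm_minus)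
      then show ?thesis
        using g add smult K by (intro exI[of _ "\<lambda>x. complex_of_real (g x)"]) (auto elim!: Reals_cases)
    next
      case True
      \<comment> \<open>The complex-linear functional with real part \<open>g\<close>, that is g(x)
        - i g(i x).\<close>
      define f where "f x = Complex (g x) (- g (\<i> \<odot> x))" for x
      have fadd: "f (x \<oplus> y) = f x + f y" if "x \<in> carrier E" "y \<in> carrier E" for x y
        using that True by (simp add: f_def add smult_rules complex_eq_iff)
      have fsmult: "f (a \<odot> x) = a * f x" if x: "x \<in> carrier E" for a x
      proof -
        have g_smult: "g (b \<odot> x) = Re b * g x + Im b * g (\<i> \<odot> x)" for b
        proof -
          have "b = complex_of_real (Re b) + complex_of_real (Im b) * \<i>"
            by (simp add: complex_eq_iff)
          then have "b \<odot> x = complex_of_real (Re b) \<odot> x \<oplus> complex_of_real (Im b) \<odot> (\<i> \<odot> x)"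
            using smult_rules(2)[of "complex_of_real (Re b)" "complex_of_real (Im b) * \<i>" x]
              smult_rules(4)[of "complex_of_real (Im b)" \<i> x] x True by simp
          then show ?thesis using x True by (simp add: smult_rules add smult)
        qed
        have "\<i> \<odot> (a \<odot> x) = (\<i> * a) \<odot> x"
          using smult_rules(4)[of \<i> a x] x True by simp
        then show ?thesis
          using g_smult[of a] g_smult[of "\<i> * a"] by (simp add: f_def complex_eq_iff)
      qed
      have fle: "cmod (f x) \<le> vnorm E x" if x: "x \<in> carrier E" for x
      proof (cases "f x = 0")
        case False
        \<comment> \<open>Turning \<open>x\<close> by the unimodular \<open>a\<close> makes the
          value of \<open>f\<close> real and nonnegative, so the bound on the real part
          \<open>g\<close> bounds the modulus.\<close>
        define a where "a = cmod (f x) / f x"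
        have "a * f x = cmod (f x)" "cmod a = 1" using False by (auto simp: a_def norm_divide)
        then have "cmod (f x) = Re (f (a \<odot> x))" using fsmult[OF x, of a] by simp
        also have "\<dots> \<le> vnorm E (a \<odot> x)"
          using le[of "a \<odot> x"] x True by (simp add: f_def smult_rules)
        also have "\<dots> = vnorm E x" using x True \<open>cmod a = 1\<close> by (simp add: vnorm_smult)
        finally show ?thesis .
      qed (simp add: vnorm_nonneg x)
      have Re: "Re (f x0) = vnorm E x0" using g by (simp add: f_def)
      \<comment> \<open>The real part of \<open>f x0\<close> already exhausts the bound on the
        modulus, which leaves no room for an imaginary part.\<close>
      have "(Re (f x0))\<^sup>2 + (Im (f x0))\<^sup>2 \<le> (vnorm E x0)\<^sup>2"
        using power_mono[OF fle[OF x0(1)], of 2] by (simp add: cmod_power2)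
      then have "Im (f x0) = 0" using Re by simp
      then have "f x0 = vnorm E x0" using Re by (simp add: complex_eq_iff)
      then show ?thesis using fadd fsmult fle True by (intro exI[of _ f]) auto
    qed
  qed
  then obtain f where f: "\<And>x. x \<in> carrier E \<Longrightarrow> f x \<in> K"
    "\<And>x. x \<in> carrier E \<Longrightarrow> cmod (f x) \<le> vnorm E x" "f x0 = vnorm E x0"
    "\<And>x y. x \<in> carrier E \<Longrightarrow> y \<in> carrier E \<Longrightarrow> f (x \<oplus> y) = f x + f y"
    "\<And>a x. a \<in> K \<Longrightarrow> x \<in> carrier E \<Longrightarrow> f (a \<odot> x) = a * f x"
    by blast
  define x1 where "x1 = complex_of_real (1 / vnorm E x0) \<odot> x0"
  have pos: "vnorm E x0 > 0" using vnorm_pos x0 by blast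
  have x1: "x1 \<in> carrier E" "vnorm E x1 = 1"
    unfolding x1_def by (rule normalized_vector[OF x0])+
  have "f x1 = complex_of_real (1 / vnorm E x0) * complex_of_real (vnorm E x0)"
    using x0(1) unfolding x1_def by (simp add: scalars_closed f(3,5) del: of_real_divide)
  also have "\<dots> = 1"
    using pos by simp
  finally have f_x1: "f x1 = 1" .
  have "op_norm E (scalar_space K) f = 1"
    by (rule op_norm_eqI) (use f(2) x1 f_x1 in \<open>auto simp: scalar_simps intro!: bexI[of _ x1]\<close>)
  moreover have "f \<in> bounded_ops K E (scalar_space K)"
    using f by (auto simp: bounded_ops_def scalar_simps intro!: exI[of _ 1])
  ultimately show ?thesis using f(3) that by (simp add: dual_unit_sphere_def)
qed

section \<open>Numerical radius and numerical index\<close>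

text \<open>\<open>F\<close> is asked only for homogeneity of its norm, so that one proof serves
  operators on \<open>E\<close> as well as functionals with values in
  \<open>scalar_space K\<close>.\<close>

lemma vnorm_le_op_norm:
  assumes T: "T \<in> bounded_ops K E F" and x: "x \<in> carrier E"
    and F: "\<And>a y. a \<in> K \<Longrightarrow> y \<in> carrier F \<Longrightarrow> vnorm F (a \<odot>\<^bsub>F\<^esub> y) = cmod a * vnorm F y"
  shows "vnorm F (T x) \<le> op_norm E F T * vnorm E x"
proof -
  have Tc: "T z \<in> carrier F" and Ts: "a \<in> K \<Longrightarrow> T (a \<odot> z) = a \<odot>\<^bsub>F\<^esub> T z" if "z \<in> carrier E" for a z
    using T that by (auto simp: bounded_ops_def)
  obtain C where C: "\<And>z. z \<in> carrier E \<Longrightarrow> vnorm F (T z) \<le> C * vnorm E z"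
    using T unfolding bounded_ops_def by blast
  show ?thesis
  proof (cases "x = \<zero>")
    case True
    then have "vnorm F (T x) = 0"
      using Ts[OF x, of 0] F[of 0 "T x"] Tc[OF x] x by (simp add: smult_rules scalars_closed)
    then show ?thesis using True vnorm_zero by simp
  next
    case False
    define r where "r = vnorm E x"
    have r: "0 < r" using vnorm_pos[OF x False] by (simp add: r_def)
    define y where "y = complex_of_real (1 / r) \<odot> x"
    have y: "y \<in> carrier E" "vnorm E y = 1"
      unfolding y_def r_def by (rule normalized_vector[OF x False])+
    have "x = complex_of_real r \<odot> y"
      using x r unfolding y_def by (simp add: smult_of_real_assoc smult_rules del: of_real_divide)
    then have "vnorm F (T x) = r * vnorm F (T y)"
      using Ts[OF y(1), of "complex_of_real r"] F[of "complex_of_real r" "T y"] Tc[OF y(1)] r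
      by (simp add: scalars_closed)
    moreover have "bdd_above {vnorm F (T x) |x. x \<in> carrier E \<and> vnorm E x \<le> 1}"
    proof (rule bdd_aboveI)
      fix s assume "s \<in> {vnorm F (T x) |x. x \<in> carrier E \<and> vnorm E x \<le> 1}"
      then obtain z where z: "z \<in> carrier E" "vnorm E z \<le> 1" "s = vnorm F (T z)" by blast
      have "C * vnorm E z \<le> \<bar>C\<bar> * 1"
        using z vnorm_nonneg by (intro mult_mono) auto
      then show "s \<le> \<bar>C\<bar>" using C[OF z(1)] z(3) by simp
    qed
    then have "vnorm F (T y) \<le> op_norm E F T"
      unfolding op_norm_def using y by (intro cSup_upper) auto
    ultimately show ?thesis using r by (simp add: r_def mult.commute)
  qed
qed

lemma cmod_dual_le:
  assumes "f \<in> dual_unit_sphere K E" "x \<in> carrier E"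
  shows "cmod (f x) \<le> vnorm E x"
  using assms vnorm_le_op_norm[of f "scalar_space K" x]
  by (simp add: dual_unit_sphere_def scalar_simps norm_mult)

lemma dual_linear:
  assumes "f \<in> dual_unit_sphere K E"
  shows "x \<in> carrier E \<Longrightarrow> y \<in> carrier E \<Longrightarrow> f (x \<oplus> y) = f x + f y"
    "a \<in> K \<Longrightarrow> x \<in> carrier E \<Longrightarrow> f (a \<odot> x) = a * f x"
  using assms by (auto simp: dual_unit_sphere_def bounded_ops_def scalar_simps)

lemma bounded_op_linear:
  assumes "T \<in> bounded_ops K E E"
  shows "x \<in> carrier E \<Longrightarrow> T x \<in> carrier E"
    "x \<in> carrier E \<Longrightarrow> y \<in> carrier E \<Longrightarrow> T (x \<oplus> y) = T x \<oplus> T y"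
    "a \<in> K \<Longrightarrow> x \<in> carrier E \<Longrightarrow> T (a \<odot> x) = a \<odot> T x"
    "x \<in> carrier E \<Longrightarrow> vnorm E (T x) \<le> op_norm E E T * vnorm E x"
  using assms vnorm_le_op_norm[OF assms _ vnorm_smult] by (auto simp: bounded_ops_def)

lemma cmod_le_numerical_radius:
  assumes T: "T \<in> bounded_ops K E E" and x: "x \<in> unit_sphere E"
    and f: "f \<in> dual_unit_sphere K E" "f x = 1"
  shows "cmod (f (T x)) \<le> numerical_radius K E T"
  unfolding numerical_radius_def
proof (rule cSup_upper)
  show "bdd_above {cmod (f (T x)) |x f. x \<in> unit_sphere E \<and> f \<in> dual_unit_sphere K E \<and> f x = 1}"
  proof (rule bdd_aboveI)
    fix s assume "s \<in> {cmod (f (T x)) |x f. x \<in> unit_sphere E \<and> f \<in> dual_unit_sphere K E \<and> f x = 1}"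
    then obtain y g where "y \<in> carrier E" "vnorm E y = 1" "g \<in> dual_unit_sphere K E" "s = cmod (g (T y))"
      by (auto simp: unit_sphere_def)
    then show "s \<le> op_norm E E T"
      using cmod_dual_le[of g "T y"] bounded_op_linear(1,4)[OF T, of y] by simp
  qed
qed (use x f in blast)

text \<open>On a nonzero space the supremum in the numerical radius therefore ranges over a nonempty
  set.\<close>

lemma unit_vector_exists:
  assumes "x \<in> carrier E" "x \<noteq> \<zero>"
  obtains y f where "y \<in> unit_sphere E" "f \<in> dual_unit_sphere K E" "f y = 1"
proof -
  define y where "y = complex_of_real (1 / vnorm E x) \<odot> x"
  have y: "y \<in> carrier E" "vnorm E y = 1"
    unfolding y_def by (rule normalized_vector[OF assms])+
  moreover have "y \<noteq> \<zero>" using y vnorm_zero by force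
  ultimately show ?thesis
    using norming_functional[of y] that[of y] by (auto simp: unit_sphere_def)
qed

lemma numerical_radius_least:
  assumes "x \<in> carrier E" "x \<noteq> \<zero>"
    and "\<And>x f. x \<in> unit_sphere E \<Longrightarrow> f \<in> dual_unit_sphere K E \<Longrightarrow> f x = 1 \<Longrightarrow> cmod (f (T x)) \<le> c"
  shows "numerical_radius K E T \<le> c"
  unfolding numerical_radius_def
proof (rule cSup_least)
  show "{cmod (f (T x)) |x f. x \<in> unit_sphere E \<and> f \<in> dual_unit_sphere K E \<and> f x = 1} \<noteq> {}"
    using unit_vector_exists[OF assms(1,2)] by blast
qed (use assms(3) in auto)

lemma numerical_radius_nonneg:
  assumes T: "T \<in> bounded_ops K E E" and x: "x \<in> carrier E" "x \<noteq> \<zero>"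
  shows "0 \<le> numerical_radius K E T"
proof -
  obtain y f where "y \<in> unit_sphere E" "f \<in> dual_unit_sphere K E" "f y = 1"
    using unit_vector_exists[OF x] .
  from cmod_le_numerical_radius[OF T this] show ?thesis
    using norm_ge_zero order_trans by blast
qed

section \<open>The numerical index: zero spaces, bounds, near-minimisers\<close>

lemma op_norm_trivial:
  assumes "carrier E = {\<zero>}" "T \<in> bounded_ops K E E"
  shows "op_norm E E T = 0"
  using bounded_op_linear(1)[OF assms(2)] assms(1) vnorm_zero by (intro op_norm_eqI) auto

lemma numerical_index_trivial:
  assumes "carrier E = {\<zero>}"
  shows "numerical_index K E = Inf {}"
proof -
  have "{numerical_radius K E T |T. T \<in> bounded_ops K E E \<and> op_norm E E T = 1} = {}"
    using op_norm_trivial[OF assms] by auto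
  then show ?thesis by (simp only: numerical_index_def)
qed

lemma numerical_index_le:
  assumes T: "T \<in> bounded_ops K E E" "op_norm E E T = 1"
  shows "numerical_index K E \<le> numerical_radius K E T"
proof -
  \<comment> \<open>An operator of norm 1 exists only on a nonzero space; there numerical radii are
    nonnegative, which bounds the infimum from below.\<close>
  obtain x where x: "x \<in> carrier E" "x \<noteq> \<zero>"
  proof (cases "carrier E = {\<zero>}")
    case True
    then show ?thesis using op_norm_trivial[OF True T(1)] T(2) by simp
  qed (use that M.zero_closed in blast)
  show ?thesis
    unfolding numerical_index_def
  proof (rule cInf_lower)
    show "bdd_below {numerical_radius K E T |T. T \<in> bounded_ops K E E \<and> op_norm E E T = 1}"
      using numerical_radius_nonneg[OF _ x] by (auto intro!: bdd_belowI[of _ 0])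
  qed (use T in blast)
qed

text \<open>The identity witnesses that the infimum in the index of a nonzero space is over a
  nonempty set and is at most 1.\<close>

lemma identity_bounded_op:
  assumes x: "x \<in> carrier E" "x \<noteq> \<zero>"
  shows "(\<lambda>x. x) \<in> bounded_ops K E E" "op_norm E E (\<lambda>x. x) = 1"
proof -
  show "(\<lambda>x. x) \<in> bounded_ops K E E"
    by (auto simp: bounded_ops_def intro!: exI[of _ 1])
  obtain y f where "y \<in> unit_sphere E" "f \<in> dual_unit_sphere K E" "f y = 1"
    using unit_vector_exists[OF x] .
  then show "op_norm E E (\<lambda>x. x) = 1"
    by (intro op_norm_eqI) (auto simp: unit_sphere_def intro!: bexI[of _ y])
qed

lemma numerical_index_bounds:
  assumes x: "x \<in> carrier E" "x \<noteq> \<zero>"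
  shows "0 \<le> numerical_index K E" "numerical_index K E \<le> 1"
proof -
  note id = identity_bounded_op[OF x]
  show "0 \<le> numerical_index K E"
    unfolding numerical_index_def
    by (rule cInf_greatest) (use id numerical_radius_nonneg[OF _ x] in auto)
  have "numerical_radius K E (\<lambda>x. x) \<le> 1"
    using x by (rule numerical_radius_least) simp
  then show "numerical_index K E \<le> 1"
    using numerical_index_le[OF id] by linarith
qed

lemma near_minimal_numerical_radius:
  assumes x: "x \<in> carrier E" "x \<noteq> \<zero>" and e: "0 < e"
  obtains T where "T \<in> bounded_ops K E E" "op_norm E E T = 1"
    "numerical_radius K E T < numerical_index K E + e"
proof -
  have "{numerical_radius K E T |T. T \<in> bounded_ops K E E \<and> op_norm E E T = 1} \<noteq> {}"
    using identity_bounded_op[OF x] by blast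
  then have "\<exists>v\<in>{numerical_radius K E T |T. T \<in> bounded_ops K E E \<and> op_norm E E T = 1}.
      v < numerical_index K E + e"
    using e unfolding numerical_index_def by (intro cInf_lessD) auto
  then show ?thesis using that by blast
qed

text \<open>Lumer's estimate: \<open>I - b T\<close> is bounded below by \<open>1 - \<bar>b\<bar> w\<close>, because a norming functional
  at \<open>y\<close> detects \<open>y - b T y\<close>; apply this to \<open>y = z + b T z\<close>.\<close>

lemma numerical_radius_resolvent:
  assumes T: "T \<in> bounded_ops K E E" "op_norm E E T \<le> 1"
    and w: "numerical_radius K E T \<le> w" and b: "b \<in> K" and z: "z \<in> carrier E"
  shows "(1 - cmod b * w) * vnorm E (z \<oplus> b \<odot> T z) \<le> (1 + (cmod b)\<^sup>2) * vnorm E z"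
proof -
  note lin = bounded_op_linear[OF T(1)]
  have Tle: "vnorm E (T y) \<le> vnorm E y" if "y \<in> carrier E" for y
    using lin(4)[OF that] mult_right_mono[OF T(2) vnorm_nonneg[OF that]] by simp
  have lower: "(1 - cmod b * w) * vnorm E y \<le> vnorm E (y \<oplus> (- b) \<odot> T y)" if y: "y \<in> carrier E" for y
  proof (cases "y = \<zero>")
    case True
    have "y \<oplus> (- b) \<odot> T y \<in> carrier E" using y b lin by (simp add: smult_rules scalars_closed)
    then show ?thesis using vnorm_nonneg True vnorm_zero by simp
  next
    case False
    define r where "r = vnorm E y"
    have r: "0 < r" using vnorm_pos y False by (simp add: r_def)
    obtain f where f: "f \<in> dual_unit_sphere K E" "f y = r"
      using norming_functional[OF y False] unfolding r_def by blast
    \<comment> \<open>The numerical radius sees unit vectors only, so the bound is obtained at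
      \<open>u\<close> and scaled back to \<open>y\<close>.\<close>
    define u where "u = complex_of_real (1 / r) \<odot> y"
    have u: "u \<in> carrier E" "vnorm E u = 1"
      unfolding u_def r_def by (rule normalized_vector[OF y False])+
    have "f u = 1"
      using y r f unfolding u_def by (simp add: scalars_closed dual_linear(2) flip: of_real_mult del: of_real_divide)
    then have "cmod (f (T u)) \<le> w"
      using cmod_le_numerical_radius[OF T(1), of u f] f(1) u w by (simp add: unit_sphere_def)
    moreover have "f (T u) = complex_of_real (1 / r) * f (T y)"
      using y lin f unfolding u_def by (simp add: scalars_closed dual_linear(2) del: of_real_divide)
    ultimately have fT: "cmod (f (T y)) \<le> w * r"
      using r by (simp add: norm_divide field_simps)
    have "f (y \<oplus> (- b) \<odot> T y) = r - b * f (T y)"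
      using y b f lin by (simp add: dual_linear smult_rules scalars_closed)
    then have "r - cmod b * cmod (f (T y)) \<le> cmod (f (y \<oplus> (- b) \<odot> T y))"
      using norm_triangle_ineq2[of "complex_of_real r" "b * f (T y)"] r by (simp add: norm_mult)
    also have "\<dots> \<le> vnorm E (y \<oplus> (- b) \<odot> T y)"
      using y b lin f by (intro cmod_dual_le) (simp_all add: smult_rules scalars_closed)
    finally show ?thesis
      using mult_left_mono[OF fT, of "cmod b"] by (simp add: r_def algebra_simps)
  qed
  define y where "y = z \<oplus> b \<odot> T z"
  have y: "y \<in> carrier E" using z b lin by (simp add: y_def smult_rules)
  \<comment> \<open>The first-order terms in \<open>b\<close> cancel and only the square
    remains.\<close>
  have "y \<oplus> (- b) \<odot> T y = z \<oplus> (- (b * b)) \<odot> T (T z)"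
  proof -
    have cl: "z \<in> carrier E" "T z \<in> carrier E" "T (T z) \<in> carrier E" using z lin by auto
    have "(- b) \<odot> T y = (- b) \<odot> T z \<oplus> (- (b * b)) \<odot> T (T z)"
      using cl b lin smult_rules(4)[of "- b" b "T (T z)"] by (simp add: y_def smult_rules scalars_closed)
    moreover have "b \<odot> T z \<oplus> ((- b) \<odot> T z \<oplus> v) = v" if "v \<in> carrier E" for v
      using cl b that by (simp add: smult_uminus smult_rules M.r_neg2)
    ultimately show ?thesis
      using cl b by (simp add: y_def M.a_assoc smult_rules scalars_closed)
  qed
  then have "vnorm E (y \<oplus> (- b) \<odot> T y) \<le> vnorm E z + (cmod b)\<^sup>2 * vnorm E (T (T z))"
    using vnorm_triangle[of z "(- (b * b)) \<odot> T (T z)"] z lin b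
    by (simp add: smult_rules scalars_closed vnorm_smult norm_mult power2_eq_square)
  also have "(cmod b)\<^sup>2 * vnorm E (T (T z)) \<le> (cmod b)\<^sup>2 * vnorm E z"
    using Tle[of "T z"] Tle[of z] z lin by (intro mult_left_mono) auto
  finally have "vnorm E (y \<oplus> (- b) \<odot> T y) \<le> (1 + (cmod b)\<^sup>2) * vnorm E z"
    by (simp add: algebra_simps)
  then show ?thesis using lower[OF y] by (simp add: y_def)
qed

end

section \<open>The ultraproduct as a normed space\<close>

locale normed_ultraproduct =
  fixes K :: "complex set" and X :: "'i \<Rightarrow> 'a nspace" and U :: "'i filter"
  assumes scalars: "K = \<real> \<or> K = UNIV"
    and normed: "\<And>i. normed_space K (X i)"
    and ultra: "free_ultrafilter U"
begin

sublocale N: scalar_normed_space K "X i" for i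
  by (intro scalar_normed_space.intro scalar_normed_space_axioms.intro normed scalars)

definition cls :: "('i \<Rightarrow> 'a) \<Rightarrow> ('i \<Rightarrow> 'a) set" where
  "cls x = c0 U X +>\<^bsub>linf X\<^esub> x"

abbreviation "Q \<equiv> ultraproduct U X"

section \<open>Coordinatewise structure of bounded families\<close>

lemma nontrivial_filter: "U \<noteq> bot"
  using ultra by (simp add: free_ultrafilter_def)

lemma linf_simps:
  "zero (linf X) = (\<lambda>i. \<zero>\<^bsub>X i\<^esub>)" "add (linf X) = (\<lambda>x y i. x i \<oplus>\<^bsub>X i\<^esub> y i)"
  "smult (linf X) = (\<lambda>a x i. a \<odot>\<^bsub>X i\<^esub> x i)"
  by (simp_all add: linf_def)

lemma linfI:
  "(\<And>i. x i \<in> carrier (X i)) \<Longrightarrow> (\<And>i. vnorm (X i) (x i) \<le> B) \<Longrightarrow> x \<in> carrier (linf X)"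
  by (auto simp: linf_def intro!: bdd_aboveI2[of _ _ B])

lemma linfD: "x \<in> carrier (linf X) \<Longrightarrow> x i \<in> carrier (X i)"
  by (simp add: linf_def)

lemma linf_bounded:
  assumes "x \<in> carrier (linf X)"
  obtains B where "\<And>i. vnorm (X i) (x i) \<le> B"
  using assms by (auto simp: linf_def bdd_above_def)

lemma linf_add:
  assumes "x \<in> carrier (linf X)" "y \<in> carrier (linf X)"
  shows "(\<lambda>i. x i \<oplus>\<^bsub>X i\<^esub> y i) \<in> carrier (linf X)"
proof -
  obtain B C where "\<And>i. vnorm (X i) (x i) \<le> B" "\<And>i. vnorm (X i) (y i) \<le> C"
    using assms linf_bounded by metis
  then show ?thesis
    using assms[THEN linfD]
    by (intro linfI[of _ "B + C"]) (auto intro: order_trans[OF N.vnorm_triangle add_mono])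
qed

lemma linf_smult:
  assumes "a \<in> K" "x \<in> carrier (linf X)"
  shows "(\<lambda>i. a \<odot>\<^bsub>X i\<^esub> x i) \<in> carrier (linf X)"
proof -
  obtain B where "\<And>i. vnorm (X i) (x i) \<le> B"
    using assms linf_bounded by metis
  then show ?thesis
    using assms linfD[OF assms(2)]
    by (intro linfI[of _ "cmod a * B"]) (auto simp: N.smult_rules N.vnorm_smult mult_left_mono)
qed

lemma linf_minus:
  assumes "x \<in> carrier (linf X)"
  shows "(\<lambda>i. \<ominus>\<^bsub>X i\<^esub> x i) \<in> carrier (linf X)"
  using linf_smult[of "-1" x] assms linfD[OF assms] by (simp add: N.smult_minus_one N.scalars_closed)

lemma linf_zero: "(\<lambda>i. \<zero>\<^bsub>X i\<^esub>) \<in> carrier (linf X)"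
  by (rule linfI[of _ 0]) (simp_all add: N.vnorm_zero)

lemma abelian_group_linf: "abelian_group (linf X)"
proof (rule abelian_groupI)
  fix x assume "x \<in> carrier (linf X)"
  then show "\<exists>y\<in>carrier (linf X). y \<oplus>\<^bsub>linf X\<^esub> x = \<zero>\<^bsub>linf X\<^esub>"
    by (intro bexI[of _ "\<lambda>i. \<ominus>\<^bsub>X i\<^esub> x i"])
      (simp_all add: linf_simps linf_minus linfD N.M.l_neg)
qed (auto simp: linf_simps linf_add linf_zero linfD N.M.a_ac intro!: ext)

sublocale L: abelian_group "linf X"
  by (rule abelian_group_linf)

lemma linf_a_inv: "x \<in> carrier (linf X) \<Longrightarrow> \<ominus>\<^bsub>linf X\<^esub> x = (\<lambda>i. \<ominus>\<^bsub>X i\<^esub> x i)"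
  by (rule L.minus_equality) (simp_all add: linf_simps linf_minus linfD N.M.l_neg)

lemma c0_iff: "x \<in> c0 U X \<longleftrightarrow> x \<in> carrier (linf X) \<and> ((\<lambda>i. vnorm (X i) (x i)) \<longlongrightarrow> 0) U"
  by (simp add: c0_def)

lemma tendsto_zero_bound:
  assumes "(g \<longlongrightarrow> 0) U" "\<And>i. 0 \<le> f i" "\<And>i. f i \<le> g i"
  shows "(f \<longlongrightarrow> (0::real)) U"
  by (rule tendsto_sandwich[OF _ _ tendsto_const assms(1)]) (simp_all add: assms(2,3))

text \<open>Sums and equality of cosets can then be taken from the theory of additive
  subgroups.\<close>

lemma abelian_subgroup_c0: "abelian_subgroup (c0 U X) (linf X)"
proof (rule abelian_subgroupI3[OF additive_subgroupI abelian_group_linf])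
  show "subgroup (c0 U X) (add_monoid (linf X))"
  proof (rule subgroup.intro)
    fix x y assume x: "x \<in> c0 U X" and y: "y \<in> c0 U X"
    then have "((\<lambda>i. vnorm (X i) (x i) + vnorm (X i) (y i)) \<longlongrightarrow> 0) U"
      using tendsto_add_zero by (auto simp: c0_iff)
    then have "((\<lambda>i. vnorm (X i) (x i \<oplus>\<^bsub>X i\<^esub> y i)) \<longlongrightarrow> 0) U"
      by (rule tendsto_zero_bound)
        (use x y in \<open>simp_all add: c0_iff linfD N.vnorm_nonneg N.vnorm_triangle\<close>)
    then show "x \<otimes>\<^bsub>add_monoid (linf X)\<^esub> y \<in> c0 U X"
      using x y linf_add by (simp add: c0_iff linf_simps)
  next
    fix x assume x: "x \<in> c0 U X"
    then have "\<ominus>\<^bsub>linf X\<^esub> x \<in> c0 U X"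
      by (simp add: c0_iff linf_a_inv linf_minus linfD N.vnorm_minus)
    then show "inv\<^bsub>add_monoid (linf X)\<^esub> x \<in> c0 U X"
      by (simp add: a_inv_def)
  qed (auto simp: c0_iff linf_simps linf_zero N.vnorm_zero)
qed

sublocale C: abelian_subgroup "c0 U X" "linf X"
  by (rule abelian_subgroup_c0)

section \<open>Classes modulo \<open>c0 U X\<close> and their norms\<close>

lemma mem_cls:
  assumes x: "x \<in> carrier (linf X)"
  shows "y \<in> cls x \<longleftrightarrow>
    y \<in> carrier (linf X) \<and> ((\<lambda>i. vnorm (X i) (y i \<oplus>\<^bsub>X i\<^esub> \<ominus>\<^bsub>X i\<^esub> x i)) \<longlongrightarrow> 0) U"
    (is "?l \<longleftrightarrow> ?r")
proof
  assume ?l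
  then obtain h where h: "h \<in> c0 U X" and y: "y = (\<lambda>i. h i \<oplus>\<^bsub>X i\<^esub> x i)"
    by (auto simp: cls_def a_r_coset_def' linf_simps)
  have "y i \<oplus>\<^bsub>X i\<^esub> \<ominus>\<^bsub>X i\<^esub> x i = h i" for i
    using h linfD[OF x, of i] linfD[of h i] by (simp add: y c0_iff N.M.a_assoc N.M.r_neg)
  then show ?r
    using h x by (simp add: c0_iff) (simp add: y linf_add)
next
  assume r: ?r
  define h where "h i = y i \<oplus>\<^bsub>X i\<^esub> \<ominus>\<^bsub>X i\<^esub> x i" for i
  have "h \<in> c0 U X"
    using r linf_add[OF _ linf_minus[OF x], of y] by (simp add: c0_iff h_def[abs_def])
  moreover have "y = (\<lambda>i. h i \<oplus>\<^bsub>X i\<^esub> x i)"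
    using r linfD[OF x] linfD[of y] by (auto simp: h_def N.M.a_assoc N.M.l_neg)
  ultimately show ?l
    by (auto simp: cls_def a_r_coset_def' linf_simps)
qed

lemma cls_self: "x \<in> carrier (linf X) \<Longrightarrow> x \<in> cls x"
  by (simp add: cls_def C.a_rcos_self)

lemma cls_eq_iff:
  assumes x: "x \<in> carrier (linf X)" and y: "y \<in> carrier (linf X)"
  shows "cls y = cls x \<longleftrightarrow> ((\<lambda>i. vnorm (X i) (y i \<oplus>\<^bsub>X i\<^esub> \<ominus>\<^bsub>X i\<^esub> x i)) \<longlongrightarrow> 0) U"
  using mem_cls[OF x, of y] cls_self[OF y] y L.a_repr_independence[OF _ x C.a_subgroup, of y]
  by (auto simp: cls_def)

lemma carrier_ultraproduct: "carrier Q = cls ` carrier (linf X)"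
  by (auto simp: ultraproduct_def quotient_space_def A_RCOSETS_def' cls_def)

lemma zero_ultraproduct: "\<zero>\<^bsub>Q\<^esub> = cls (\<lambda>i. \<zero>\<^bsub>X i\<^esub>)"
proof -
  have "c0 U X +>\<^bsub>linf X\<^esub> \<zero>\<^bsub>linf X\<^esub> = c0 U X"
    by (rule L.a_coset_add_zero) (auto simp: c0_iff)
  then show ?thesis
    by (simp add: ultraproduct_def quotient_space_def cls_def linf_simps)
qed

lemma add_ultraproduct:
  "x \<in> carrier (linf X) \<Longrightarrow> y \<in> carrier (linf X) \<Longrightarrow> cls x \<oplus>\<^bsub>Q\<^esub> cls y = cls (\<lambda>i. x i \<oplus>\<^bsub>X i\<^esub> y i)"
  using C.a_rcos_sum[of x y] by (simp add: ultraproduct_def quotient_space_def cls_def linf_simps)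

text \<open>The product in \<open>quotient_space\<close> is a union over all representatives. By
  homogeneity of the norms, equivalent representatives contribute the same class, so the union is
  that single class.\<close>

lemma smult_ultraproduct:
  assumes a: "a \<in> K" and x: "x \<in> carrier (linf X)"
  shows "a \<odot>\<^bsub>Q\<^esub> cls x = cls (\<lambda>i. a \<odot>\<^bsub>X i\<^esub> x i)"
proof -
  have "cls (\<lambda>i. a \<odot>\<^bsub>X i\<^esub> y i) = cls (\<lambda>i. a \<odot>\<^bsub>X i\<^esub> x i)" if "y \<in> cls x" for y
  proof -
    have y: "y \<in> carrier (linf X)" "((\<lambda>i. vnorm (X i) (y i \<oplus>\<^bsub>X i\<^esub> \<ominus>\<^bsub>X i\<^esub> x i)) \<longlongrightarrow> 0) U"
      using that mem_cls[OF x] by auto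
    have "a \<odot>\<^bsub>X i\<^esub> y i \<oplus>\<^bsub>X i\<^esub> \<ominus>\<^bsub>X i\<^esub> (a \<odot>\<^bsub>X i\<^esub> x i) = a \<odot>\<^bsub>X i\<^esub> (y i \<oplus>\<^bsub>X i\<^esub> \<ominus>\<^bsub>X i\<^esub> x i)" for i
      using a linfD[OF x] linfD[OF y(1)]
      by (simp add: N.smult_rules N.smult_r_minus N.scalar_simps)
    then have "((\<lambda>i. vnorm (X i) (a \<odot>\<^bsub>X i\<^esub> y i \<oplus>\<^bsub>X i\<^esub> \<ominus>\<^bsub>X i\<^esub> (a \<odot>\<^bsub>X i\<^esub> x i))) \<longlongrightarrow> 0) U"
      using tendsto_mult_right_zero[OF y(2), of "cmod a"] a linfD[OF x] linfD[OF y(1)]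
      by (simp add: N.vnorm_smult)
    then show ?thesis
      using a x y(1) by (subst cls_eq_iff) (simp_all add: linf_smult)
  qed
  then have "(\<Union>y\<in>cls x. cls (\<lambda>i. a \<odot>\<^bsub>X i\<^esub> y i)) = (\<Union>y\<in>cls x. cls (\<lambda>i. a \<odot>\<^bsub>X i\<^esub> x i))"
    by (intro SUP_cong refl)
  also have "\<dots> = cls (\<lambda>i. a \<odot>\<^bsub>X i\<^esub> x i)"
    using cls_self[OF x] by blast
  finally show ?thesis
    by (simp add: ultraproduct_def quotient_space_def linf_simps flip: cls_def)
qed

text \<open>The bridge between factors and ultraproduct: identities and inequalities of norms valid
  in almost all factors pass to classes by taking limits along \<open>U\<close>.\<close>

lemma tendsto_vnorm_cls:
  assumes x: "x \<in> carrier (linf X)"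
  shows "((\<lambda>i. vnorm (X i) (x i)) \<longlongrightarrow> vnorm Q (cls x)) U"
proof -
  obtain B where "\<And>i. vnorm (X i) (x i) \<le> B"
    using x linf_bounded by blast
  then have "bounded (range (\<lambda>i. vnorm (X i) (x i)))"
    using N.vnorm_nonneg[OF linfD[OF x]] by (intro boundedI[of _ B]) auto
  then show ?thesis
    using free_ultrafilter_tendsto_Lim[OF ultra] vnorm_ultraproduct[OF scalars ultra normed x]
    by (simp add: cls_def)
qed

lemma abelian_group_ultraproduct: "abelian_group Q"
proof (rule abelian_groupI)
  fix A assume "A \<in> carrier Q"
  then obtain x where x: "x \<in> carrier (linf X)" "A = cls x"
    by (auto simp: carrier_ultraproduct)
  then show "\<exists>B\<in>carrier Q. B \<oplus>\<^bsub>Q\<^esub> A = \<zero>\<^bsub>Q\<^esub>"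
    by (intro bexI[of _ "cls (\<lambda>i. \<ominus>\<^bsub>X i\<^esub> x i)"])
      (simp_all add: carrier_ultraproduct zero_ultraproduct add_ultraproduct linf_minus linfD N.M.l_neg)
qed (auto simp: carrier_ultraproduct zero_ultraproduct add_ultraproduct linf_add linf_zero linfD
    N.M.a_ac)

lemma normed_space_ultraproduct: "normed_space K Q"
proof -
  note simps = carrier_ultraproduct add_ultraproduct smult_ultraproduct linf_add linf_smult linfD
    N.scalar_simps N.smult_rules N.scalars_closed
  have "module (scalar_space K) Q"
  proof (rule moduleI)
    show "cring (scalar_space K)" using N.R.is_cring by blast
    show "abelian_group Q" by (rule abelian_group_ultraproduct)
  qed (auto simp: simps)
  moreover have "normed_space_axioms K Q"
  proof (rule normed_space_axioms.intro)
    fix A assume "A \<in> carrier Q"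
    then obtain x where x: "x \<in> carrier (linf X)" "A = cls x"
      by (auto simp: carrier_ultraproduct)
    have "A = \<zero>\<^bsub>Q\<^esub> \<longleftrightarrow> ((\<lambda>i. vnorm (X i) (x i)) \<longlongrightarrow> 0) U"
      using x cls_eq_iff[OF linf_zero x(1)] by (simp add: zero_ultraproduct linfD N.minus_zero)
    then show "vnorm Q A = 0 \<longleftrightarrow> A = \<zero>\<^bsub>Q\<^esub>"
      using tendsto_vnorm_cls[OF x(1)] tendsto_unique[OF nontrivial_filter] x(2) by auto
  next
    fix a A assume a: "a \<in> K" and "A \<in> carrier Q"
    then obtain x where x: "x \<in> carrier (linf X)" "A = cls x"
      by (auto simp: carrier_ultraproduct)
    have "((\<lambda>i. cmod a * vnorm (X i) (x i)) \<longlongrightarrow> vnorm Q (a \<odot>\<^bsub>Q\<^esub> A)) U"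
      using tendsto_vnorm_cls[OF linf_smult[OF a x(1)]] a x
      by (simp add: smult_ultraproduct N.vnorm_smult linfD)
    moreover have "((\<lambda>i. cmod a * vnorm (X i) (x i)) \<longlongrightarrow> cmod a * vnorm Q A) U"
      using tendsto_mult_left[OF tendsto_vnorm_cls[OF x(1)]] x(2) by simp
    ultimately show "vnorm Q (a \<odot>\<^bsub>Q\<^esub> A) = cmod a * vnorm Q A"
      using tendsto_unique[OF nontrivial_filter] by blast
  next
    fix A B assume "A \<in> carrier Q" "B \<in> carrier Q"
    then obtain x y where x: "x \<in> carrier (linf X)" "A = cls x" and y: "y \<in> carrier (linf X)" "B = cls y"
      by (auto simp: carrier_ultraproduct)
    show "vnorm Q (A \<oplus>\<^bsub>Q\<^esub> B) \<le> vnorm Q A + vnorm Q B"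
    proof (rule tendsto_le[OF nontrivial_filter])
      show "((\<lambda>i. vnorm (X i) (x i) + vnorm (X i) (y i)) \<longlongrightarrow> vnorm Q A + vnorm Q B) U"
        using tendsto_add[OF tendsto_vnorm_cls[OF x(1)] tendsto_vnorm_cls[OF y(1)]] x y by simp
      show "((\<lambda>i. vnorm (X i) (x i \<oplus>\<^bsub>X i\<^esub> y i)) \<longlongrightarrow> vnorm Q (A \<oplus>\<^bsub>Q\<^esub> B)) U"
        using tendsto_vnorm_cls[OF linf_add[OF x(1) y(1)]] x y by (simp add: add_ultraproduct)
    qed (use x y N.vnorm_triangle in \<open>simp add: linfD\<close>)
  qed
  ultimately show ?thesis by (rule normed_space.intro)
qed

sublocale Q: scalar_normed_space K "ultraproduct U X"
  by (intro scalar_normed_space.intro scalar_normed_space_axioms.intro normed_space_ultraproduct scalars)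

section \<open>Ultraproducts of operators\<close>

text \<open>The representative is arbitrary; for linear contractions \<open>T i\<close> the result
  does not depend on it, by \<open>op_ultraproduct_cls\<close>.\<close>

definition op_ultraproduct :: "('i \<Rightarrow> 'a \<Rightarrow> 'a) \<Rightarrow> ('i \<Rightarrow> 'a) set \<Rightarrow> ('i \<Rightarrow> 'a) set" where
  "op_ultraproduct T A = cls (\<lambda>i. T i ((SOME x. x \<in> A) i))"

context
  fixes T :: "'i \<Rightarrow> 'a \<Rightarrow> 'a"
  assumes T: "\<And>i. T i \<in> bounded_ops K (X i) (X i)"
    and T_le: "\<And>i. op_norm (X i) (X i) (T i) \<le> 1"
begin

lemma vnorm_op_le: "x \<in> carrier (X i) \<Longrightarrow> vnorm (X i) (T i x) \<le> vnorm (X i) x"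
  using N.bounded_op_linear(4)[OF T, of x i] mult_right_mono[OF T_le[of i] N.vnorm_nonneg[of x i]]
  by simp

lemma op_linf: "x \<in> carrier (linf X) \<Longrightarrow> (\<lambda>i. T i (x i)) \<in> carrier (linf X)"
proof -
  assume x: "x \<in> carrier (linf X)"
  then obtain B where "\<And>i. vnorm (X i) (x i) \<le> B" using linf_bounded by blast
  then show ?thesis
    using N.bounded_op_linear(1)[OF T] linfD[OF x]
    by (intro linfI[of _ B]) (auto intro: order_trans[OF vnorm_op_le])
qed

text \<open>By linearity the images of two representatives differ by the image of their difference,
  and contractions keep that difference in \<open>c0 U X\<close>.\<close>

lemma op_ultraproduct_cls:
  assumes x: "x \<in> carrier (linf X)"
  shows "op_ultraproduct T (cls x) = cls (\<lambda>i. T i (x i))"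
proof -
  define y where "y = (SOME y. y \<in> cls x)"
  have "y \<in> cls x" unfolding y_def using cls_self[OF x] by (rule someI[of "\<lambda>y. y \<in> cls x"])
  then have y: "y \<in> carrier (linf X)" "((\<lambda>i. vnorm (X i) (y i \<oplus>\<^bsub>X i\<^esub> \<ominus>\<^bsub>X i\<^esub> x i)) \<longlongrightarrow> 0) U"
    using mem_cls[OF x] by auto
  note xy = linfD[OF x] linfD[OF y(1)]
  note lin = N.bounded_op_linear(1-3)[OF T]
  have diff: "T i (y i) \<oplus>\<^bsub>X i\<^esub> \<ominus>\<^bsub>X i\<^esub> T i (x i) = T i (y i \<oplus>\<^bsub>X i\<^esub> \<ominus>\<^bsub>X i\<^esub> x i)" for i
    using xy[of i] lin(2)[of "y i" i "(-1) \<odot>\<^bsub>X i\<^esub> x i"] lin(3)[of "-1" "x i" i] lin(1)[of _ i]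
    by (simp add: N.smult_minus_one N.scalars_closed)
  have "((\<lambda>i. vnorm (X i) (T i (y i) \<oplus>\<^bsub>X i\<^esub> \<ominus>\<^bsub>X i\<^esub> T i (x i))) \<longlongrightarrow> 0) U"
    unfolding diff
    by (rule tendsto_zero_bound[OF y(2)]) (use xy lin(1) in \<open>simp_all add: N.vnorm_nonneg vnorm_op_le\<close>)
  then have "cls (\<lambda>i. T i (y i)) = cls (\<lambda>i. T i (x i))"
    using op_linf x y(1) by (subst cls_eq_iff) auto
  then show ?thesis by (simp add: op_ultraproduct_def y_def)
qed

lemma op_ultraproduct_bounded: "op_ultraproduct T \<in> bounded_ops K Q Q"
  and vnorm_op_ultraproduct_le: "A \<in> carrier Q \<Longrightarrow> vnorm Q (op_ultraproduct T A) \<le> vnorm Q A"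
proof -
  note lin = N.bounded_op_linear(1-3)[OF T]
  show le: "vnorm Q (op_ultraproduct T A) \<le> vnorm Q A" if "A \<in> carrier Q" for A
  proof -
    obtain x where x: "x \<in> carrier (linf X)" "A = cls x"
      using \<open>A \<in> carrier Q\<close> by (auto simp: carrier_ultraproduct)
    show ?thesis
      unfolding x(2) op_ultraproduct_cls[OF x(1)]
      by (rule tendsto_le[OF nontrivial_filter tendsto_vnorm_cls[OF x(1)]
            tendsto_vnorm_cls[OF op_linf[OF x(1)]]])
        (use x in \<open>simp add: vnorm_op_le linfD\<close>)
  qed
  have "op_ultraproduct T \<in> carrier Q \<rightarrow> carrier Q"
    by (auto simp: carrier_ultraproduct op_ultraproduct_cls op_linf)
  moreover have "op_ultraproduct T (A \<oplus>\<^bsub>Q\<^esub> B) = op_ultraproduct T A \<oplus>\<^bsub>Q\<^esub> op_ultraproduct T B"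
    if "A \<in> carrier Q" "B \<in> carrier Q" for A B
    using that by (auto simp: carrier_ultraproduct op_ultraproduct_cls add_ultraproduct op_linf
        linf_add linfD lin)
  moreover have "op_ultraproduct T (a \<odot>\<^bsub>Q\<^esub> A) = a \<odot>\<^bsub>Q\<^esub> op_ultraproduct T A"
    if "a \<in> K" "A \<in> carrier Q" for a A
    using that by (auto simp: carrier_ultraproduct op_ultraproduct_cls smult_ultraproduct op_linf
        linf_smult linfD lin)
  ultimately show "op_ultraproduct T \<in> bounded_ops K Q Q"
    using le unfolding bounded_ops_def by (auto intro!: exI[of _ 1])
qed

text \<open>The upper bound 1 passes to the limit. For the lower bound, vectors that nearly norm the
  \<open>T i\<close> are assembled into one bounded family.\<close>

lemma op_norm_op_ultraproduct:
  assumes norm: "\<forall>\<^sub>F i in U. op_norm (X i) (X i) (T i) = 1"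
  shows "op_norm Q Q (op_ultraproduct T) = 1"
proof (rule Q.op_norm_eqI)
  fix d :: real assume d: "d < 1"
  \<comment> \<open>The zero vector fills the coordinates where no suitable vector exists and keeps
    the family in the unit balls; by \<open>norm\<close>, almost all coordinates do have
    one.\<close>
  define x where "x i = (if \<exists>x\<in>carrier (X i). vnorm (X i) x \<le> 1 \<and> d \<le> vnorm (X i) (T i x)
      then SOME x. x \<in> carrier (X i) \<and> vnorm (X i) x \<le> 1 \<and> d \<le> vnorm (X i) (T i x)
      else \<zero>\<^bsub>X i\<^esub>)" for i
  have ex: "x i \<in> carrier (X i) \<and> vnorm (X i) (x i) \<le> 1 \<and> d \<le> vnorm (X i) (T i (x i))"
    if "\<exists>x\<in>carrier (X i). vnorm (X i) x \<le> 1 \<and> d \<le> vnorm (X i) (T i x)" for i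
    using that someI_ex[of "\<lambda>x. x \<in> carrier (X i) \<and> vnorm (X i) x \<le> 1 \<and> d \<le> vnorm (X i) (T i x)"]
    by (auto simp: x_def)
  have xi: "x i \<in> carrier (X i) \<and> vnorm (X i) (x i) \<le> 1" for i
    using ex[of i] by (cases "\<exists>x\<in>carrier (X i). vnorm (X i) x \<le> 1 \<and> d \<le> vnorm (X i) (T i x)")
      (auto simp: x_def N.vnorm_zero)
  then have x: "x \<in> carrier (linf X)" by (intro linfI[of _ 1]) auto
  have "\<forall>\<^sub>F i in U. d \<le> vnorm (X i) (T i (x i))"
    using norm
  proof eventually_elim
    case (elim i)
    have "{vnorm (X i) (T i x) |x. x \<in> carrier (X i) \<and> vnorm (X i) x \<le> 1} \<noteq> {}"
      using xi by blast
    then have "\<exists>v\<in>{vnorm (X i) (T i x) |x. x \<in> carrier (X i) \<and> vnorm (X i) x \<le> 1}. d < v"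
      using d elim unfolding op_norm_def by (intro less_cSupD) auto
    then show ?case using ex[of i] by force
  qed
  then have "d \<le> vnorm Q (op_ultraproduct T (cls x))"
    unfolding op_ultraproduct_cls[OF x]
    using tendsto_lowerbound[OF tendsto_vnorm_cls[OF op_linf[OF x]] _ nontrivial_filter] by blast
  moreover have "vnorm Q (cls x) \<le> 1"
    by (rule tendsto_upperbound[OF tendsto_vnorm_cls[OF x] _ nontrivial_filter]) (simp add: xi)
  moreover have "cls x \<in> carrier Q" using x by (simp add: carrier_ultraproduct)
  ultimately show "\<exists>A\<in>carrier Q. vnorm Q A \<le> 1 \<and> d \<le> vnorm Q (op_ultraproduct T A)" by blast
qed (simp_all add: vnorm_op_ultraproduct_le)

text \<open>The functional \<open>f\<close> is used only to bound the norm of \<open>cls z\<close>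
  from below. That norm is a limit of norms in the factors, to which
  \<open>numerical_radius_resolvent\<close> applies.\<close>

lemma numerical_radius_op_ultraproduct_le:
  assumes A: "A \<in> carrier Q" "A \<noteq> \<zero>\<^bsub>Q\<^esub>"
    and w: "\<forall>\<^sub>F i in U. numerical_radius K (X i) (T i) \<le> w"
  shows "numerical_radius K Q (op_ultraproduct T) \<le> w"
  using A
proof (rule Q.numerical_radius_least)
  fix B f assume B: "B \<in> unit_sphere Q" and f: "f \<in> dual_unit_sphere K Q" "f B = 1"
  obtain x where x: "x \<in> carrier (linf X)" "B = cls x"
    using B by (auto simp: unit_sphere_def carrier_ultraproduct)
  have nB: "vnorm Q B = 1" "B \<in> carrier Q" using B by (auto simp: unit_sphere_def)
  define S where "S = op_ultraproduct T B"
  have S: "S \<in> carrier Q" "S = cls (\<lambda>i. T i (x i))"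
    using x op_linf by (simp_all add: S_def op_ultraproduct_cls carrier_ultraproduct)
  define t where "t = cmod (f S)"
  have fK: "f S \<in> K"
    using f(1) S(1) by (auto simp: dual_unit_sphere_def bounded_ops_def N.scalar_simps)
  \<comment> \<open>A scalar of modulus 1 that turns \<open>f S\<close> into its modulus; over the
    reals it is a sign.\<close>
  obtain \<theta> where \<theta>: "\<theta> \<in> K" "cmod \<theta> = 1" "\<theta> * f S = t"
  proof (cases "f S = 0")
    case True
    then show ?thesis using that[of 1] by (simp add: t_def N.scalars_closed)
  next
    case False
    then show ?thesis
      using that[of "complex_of_real t * inverse (f S)"] fK
      by (simp add: t_def N.scalars_closed norm_mult norm_inverse)
  qed
  \<comment> \<open>The condition \<open>a * w \<le> 1\<close> makes \<open>1 - a * w\<close>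
    nonnegative, so multiplying the lower bound for the norm of \<open>cls z\<close> by it keeps the
    direction.\<close>
  have key: "(1 - a * w) * (1 + a * t) \<le> 1 + a\<^sup>2" if a: "0 < a" "a * w \<le> 1" for a
  proof -
    define b where "b = complex_of_real a * \<theta>"
    have b: "b \<in> K" "cmod b = a" using a \<theta> by (simp_all add: b_def N.scalars_closed norm_mult)
    define z where "z = (\<lambda>i. x i \<oplus>\<^bsub>X i\<^esub> b \<odot>\<^bsub>X i\<^esub> T i (x i))"
    have z: "z \<in> carrier (linf X)" "cls z = B \<oplus>\<^bsub>Q\<^esub> b \<odot>\<^bsub>Q\<^esub> S"
      using x S b op_linf
      by (simp_all add: z_def linf_add linf_smult add_ultraproduct smult_ultraproduct)
    have "f (cls z) = 1 + complex_of_real a * (\<theta> * f S)"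
      using z(2) f S(1) nB b by (simp add: Q.dual_linear Q.smult_rules b_def)
    then have "f (cls z) = complex_of_real (1 + a * t)" using \<theta> by simp
    then have "1 + a * t = cmod (f (cls z))"
      using a by (simp add: t_def flip: of_real_add of_real_mult)
    also have "\<dots> \<le> vnorm Q (cls z)"
      using f(1) z(1) by (intro Q.cmod_dual_le) (simp_all add: carrier_ultraproduct)
    finally have "(1 - a * w) * (1 + a * t) \<le> (1 - a * w) * vnorm Q (cls z)"
      using a by (intro mult_left_mono) auto
    also have "\<dots> \<le> (1 + a\<^sup>2) * vnorm Q (cls x)"
    proof (rule tendsto_le[OF nontrivial_filter])
      show "((\<lambda>i. (1 + a\<^sup>2) * vnorm (X i) (x i)) \<longlongrightarrow> (1 + a\<^sup>2) * vnorm Q (cls x)) U"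
        by (rule tendsto_mult_left[OF tendsto_vnorm_cls[OF x(1)]])
      show "((\<lambda>i. (1 - a * w) * vnorm (X i) (z i)) \<longlongrightarrow> (1 - a * w) * vnorm Q (cls z)) U"
        by (rule tendsto_mult_left[OF tendsto_vnorm_cls[OF z(1)]])
      show "\<forall>\<^sub>F i in U. (1 - a * w) * vnorm (X i) (z i) \<le> (1 + a\<^sup>2) * vnorm (X i) (x i)"
        using w
      proof eventually_elim
        case (elim i)
        then show ?case
          using N.numerical_radius_resolvent[OF T T_le elim b(1) linfD[OF x(1)]] b(2)
          by (simp add: z_def)
      qed
    qed
    finally show ?thesis using nB x by simp
  qed
  show "cmod (f (op_ultraproduct T B)) \<le> w"
  proof -
    \<comment> \<open>In \<open>key\<close> the constant 1 cancels; dividing what is left by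
      \<open>a\<close> gives this inequality, and letting \<open>a\<close> tend to 0 leaves
      \<open>t \<le> w\<close>.\<close>
    have "\<forall>\<^sub>F a in at_right 0. t - w - a * t * w \<le> a"
    proof -
      have "\<forall>\<^sub>F a in at_right 0. a * w < 1"
        by (rule order_tendstoD(2)[of _ 0]) (auto intro!: tendsto_eq_intros)
      then show ?thesis
        using eventually_at_right_less[of 0]
      proof eventually_elim
        case (elim a)
        have "a * (t - w - a * t * w) \<le> a * a"
          using key[of a] elim by (simp add: algebra_simps power2_eq_square)
        then show ?case using elim by simp
      qed
    qed
    moreover have "((\<lambda>a. t - w - a * t * w) \<longlongrightarrow> t - w) (at_right 0)"
      by (auto intro!: tendsto_eq_intros)
    moreover have "((\<lambda>a. a) \<longlongrightarrow> (0::real)) (at_right 0)"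
      by (auto intro!: tendsto_eq_intros)
    ultimately have "t - w \<le> 0"
      using tendsto_le[of "at_right (0::real)"] trivial_limit_at_right_real by blast
    then show ?thesis by (simp add: t_def S_def)
  qed
qed

end

section \<open>Comparison of the indices\<close>

lemma tendsto_numerical_index:
  "((\<lambda>i. numerical_index K (X i)) \<longlongrightarrow> Lim U (\<lambda>i. numerical_index K (X i))) U"
proof (rule free_ultrafilter_tendsto_Lim[OF ultra], rule boundedI)
  fix c assume "c \<in> range (\<lambda>i. numerical_index K (X i))"
  then obtain i where i: "c = numerical_index K (X i)" by blast
  \<comment> \<open>Nonzero factors have an index between 0 and 1; the other summand covers the
    default value at zero factors.\<close>
  show "norm c \<le> 1 + \<bar>Inf {}\<bar>"
  proof (cases "carrier (X i) = {\<zero>\<^bsub>X i\<^esub>}")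
    case True
    then show ?thesis using N.numerical_index_trivial[OF True] by (simp add: i)
  next
    case False
    then obtain x where "x \<in> carrier (X i)" "x \<noteq> \<zero>\<^bsub>X i\<^esub>" using N.M.zero_closed[of i] by blast
    from N.numerical_index_bounds[OF this] show ?thesis by (simp add: i)
  qed
qed

theorem numerical_index_ultraproduct_le:
  "numerical_index K Q \<le> Lim U (\<lambda>i. numerical_index K (X i))" (is "_ \<le> ?l")
proof (cases "\<forall>\<^sub>F i in U. carrier (X i) = {\<zero>\<^bsub>X i\<^esub>}")
  case True
  \<comment> \<open>A representative vanishes in almost all coordinates, so its class is zero. The
    ultraproduct and almost all factors then share the index \<open>Inf {}\<close>.\<close>
  have "A = \<zero>\<^bsub>Q\<^esub>" if "A \<in> carrier Q" for A
  proof -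
    obtain x where x: "x \<in> carrier (linf X)" "A = cls x"
      using \<open>A \<in> carrier Q\<close> by (auto simp: carrier_ultraproduct)
    have "((\<lambda>i. vnorm (X i) (x i)) \<longlongrightarrow> 0) U"
    proof (rule tendsto_eventually)
      show "\<forall>\<^sub>F i in U. vnorm (X i) (x i) = 0"
        using True
      proof eventually_elim
        case (elim i)
        then show ?case using linfD[OF x(1), of i] N.vnorm_zero[of i] by auto
      qed
    qed
    then show ?thesis
      using cls_eq_iff[OF linf_zero x(1)] x by (simp add: zero_ultraproduct linfD N.minus_zero)
  qed
  then have "numerical_index K Q = Inf {}"
    by (intro Q.numerical_index_trivial) auto
  moreover have "((\<lambda>i. numerical_index K (X i)) \<longlongrightarrow> Inf {}) U"
    by (rule tendsto_eventually) (use True in eventually_elim, rule N.numerical_index_trivial)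
  then have "?l = Inf {}" by (rule tendsto_Lim[OF nontrivial_filter])
  ultimately show ?thesis by simp
next
  case False
  \<comment> \<open>For an ultrafilter, a property that fails to hold eventually is eventually
    false.\<close>
  then have nontriv: "\<forall>\<^sub>F i in U. carrier (X i) \<noteq> {\<zero>\<^bsub>X i\<^esub>}"
    using ultra by (auto simp: free_ultrafilter_def)
  show ?thesis
  proof (rule field_le_epsilon)
    fix e :: real assume e: "0 < e"
    \<comment> \<open>\<open>op_ultraproduct\<close> needs contractions in every factor; on zero
      factors the identity, of norm 0 there, fills the gap. Elsewhere \<open>e / 2\<close> is
      allowed because the infimum may not be attained.\<close>
    have "\<exists>T. T \<in> bounded_ops K (X i) (X i) \<and> op_norm (X i) (X i) T \<le> 1 \<and>
        (carrier (X i) \<noteq> {\<zero>\<^bsub>X i\<^esub>} \<longrightarrow> op_norm (X i) (X i) T = 1 \<and>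
          numerical_radius K (X i) T < numerical_index K (X i) + e / 2)" for i
    proof (cases "carrier (X i) = {\<zero>\<^bsub>X i\<^esub>}")
      case True
      have "(\<lambda>x. x) \<in> bounded_ops K (X i) (X i)"
        by (auto simp: bounded_ops_def intro!: exI[of _ 1])
      then show ?thesis using N.op_norm_trivial[OF True] True by force
    next
      case False
      then obtain x where "x \<in> carrier (X i)" "x \<noteq> \<zero>\<^bsub>X i\<^esub>" using N.M.zero_closed[of i] by blast
      from N.near_minimal_numerical_radius[OF this, of "e / 2"] e show ?thesis by fastforce
    qed
    then obtain T where T: "\<And>i. T i \<in> bounded_ops K (X i) (X i)" "\<And>i. op_norm (X i) (X i) (T i) \<le> 1"
      and Tn: "\<And>i. carrier (X i) \<noteq> {\<zero>\<^bsub>X i\<^esub>} \<Longrightarrow> op_norm (X i) (X i) (T i) = 1 \<and>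
          numerical_radius K (X i) (T i) < numerical_index K (X i) + e / 2"
      by metis
    have "\<forall>\<^sub>F i in U. op_norm (X i) (X i) (T i) = 1"
      using nontriv by eventually_elim (simp add: Tn)
    then have S: "op_ultraproduct T \<in> bounded_ops K Q Q" "op_norm Q Q (op_ultraproduct T) = 1"
      using op_ultraproduct_bounded[OF T] op_norm_op_ultraproduct[OF T] by auto
    have "carrier Q \<noteq> {\<zero>\<^bsub>Q\<^esub>}"
      using Q.op_norm_trivial[OF _ S(1)] S(2) by fastforce
    then obtain A where A: "A \<in> carrier Q" "A \<noteq> \<zero>\<^bsub>Q\<^esub>" using Q.M.zero_closed by blast
    \<comment> \<open>The other half of \<open>e\<close> is spent on the distance of the indices
      from their limit.\<close>
    have "\<forall>\<^sub>F i in U. numerical_index K (X i) < ?l + e / 2"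
      using order_tendstoD(2)[OF tendsto_numerical_index] e by simp
    with nontriv have "\<forall>\<^sub>F i in U. numerical_radius K (X i) (T i) \<le> ?l + e"
      by eventually_elim (use Tn in fastforce)
    then have "numerical_radius K Q (op_ultraproduct T) \<le> ?l + e"
      by (rule numerical_radius_op_ultraproduct_le[OF T A])
    then show "numerical_index K Q \<le> ?l + e"
      using Q.numerical_index_le[OF S] by linarith
  qed
qed

end

theorem corollary3p4:
  fixes K :: "complex set" and X :: "nat \<Rightarrow> 'a nspace" and U :: "nat filter"
  assumes "K = \<real> \<or> K = UNIV"
    and "\<And>n. banach_space K (X n)"
    and "free_ultrafilter U"
  shows "numerical_index K (ultraproduct U X) \<le> Lim U (\<lambda>n. numerical_index K (X n))"
proof -
  interpret normed_ultraproduct K X U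
    using assms by (intro normed_ultraproduct.intro banach_space.axioms(1))
  show ?thesis by (rule numerical_index_ultraproduct_le)
qed

end
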